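(* Let $L$ be an oriented link diagram with a chosen basepoint on $L$ (away from the double points), let $\mathcal{C}_{BN}=\mathcal{C}_{BN}(L)$ be its Bar-Natan complex over $\mathbb{F}_2[H]$, and let $\mathcal{C}_x$ and $\mathcal{C}_1$ be the associated reduced complexes (the subcomplex in which the basepoint circle is labelled $\boldsymbol{x}$, and the quotient complex $\mathcal{C}_{BN}/\mathcal{C}_x$, respectively). Then $$H(\mathcal{C}_{BN})\cong H(\mathcal{C}_x)\oplus H(\mathcal{C}_1)$$ as modules over $\mathbb{F}_2[H]$, where $H(\cdot)$ applied to a complex denotes its homology (in each homological degree $i$).
   Context: Let $\mathbb{F}_2$ be the field with two elements and $H$ a formal variable. For an $\mathbb{F}_2$-vector space $V$, $V[H]$ denotes the $\mathbb{F}_2[H]$-module of finite formal sums $\sum_{i\ge 0}H^i v_i$ with $v_i\in V$. **Resolutions.** Let $L$ be an oriented link diagram in the plane with $n=n_++n_-$ double points (crossings), $n_+$ positive and $n_-$ negative, ordered arbitrarily as $1,\dots,n$. Each crossing has a $0$-resolution and a $1$-resolution: the $0$-resolution is the smoothing that joins the two regions swept out when the overstrand is rotated counterclockwise until it meets the understrand, and the $1$-resolution is the other smoothing. (Equivalently, the orientation-respecting smoothing is the $0$-resolution of a positive crossing and the $1$-resolution of a negative crossing.) For $\alpha\in\{0,1\}^n$, let $D_\alpha(L)$ be the collection of disjoint circles in the plane obtained by giving crossing $j$ its $\alpha_j$-resolution for every $j$. Let $W$ be the $2$-dimensional $\mathbb{F}_2$-vector space with basis $\boldsymbol{1},\boldsymbol{x}$,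 and let $V_\alpha(L)=W^{\otimes k}$, with one tensor factor for each of the $k$ circles of $D_\alpha(L)$. A basis of $V_\alpha(L)$ is given by the labellings of the circles of $D_\alpha(L)$ by $\boldsymbol{1}$ and $\boldsymbol{x}$. **Chain groups.** $C_i=\bigoplus_{\alpha:\,w(\alpha)=i+n_-}V_\alpha(L)$, where $w(\alpha)$ is the number of $1$'s in $\alpha$. **Edge maps.** If $\beta$ is obtained from $\alpha$ by changing one coordinate from $0$ to $1$, then passing from $D_\alpha(L)$ to $D_\beta(L)$ either merges two circles into one (a merge) or splits one circle into two (a split), and leaves the other circles unchanged. Define $d_{\alpha,\beta},h_{\alpha,\beta}:V_\alpha(L)\to V_\beta(L)$ to be the identity on the tensor factors of the unchanged circles and, on the circles involved, $d_{\alpha,\beta}$ is $m$ for a merge and $\Delta$ for a split, while $h_{\alpha,\beta}$ is $m'$ for a merge and $\Delta'$ for a split, where - $m(\boldsymbol{1}\otimes\boldsymbol{1})=\boldsymbol{1}$, $m(\boldsymbol{1}\otimes\boldsymbol{x})=m(\boldsymbol{x}\otimes\boldsymbol{1})=\boldsymbol{x}$, $m(\boldsymbol{x}\otimes\boldsymbol{x})=0$; - $\Delta(\boldsymbol{1})=\boldsymbol{1}\otimes\boldsymbol{x}+\boldsymbol{x}\otimes\boldsymbol{1}$, $\Delta(\boldsymbol{x})=\boldsymbol{x}\otimes\boldsymbol{x}$; - $m'(\boldsymbol{x}\otimes\boldsymbol{x})=\boldsymbol{x}$, and $m'$ is $0$ on the other basis vectors; - $\Delta'(\boldsymbol{1})=\boldsymbol{1}\otimes\boldsymbol{1}$,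 $\Delta'(\boldsymbol{x})=0$. Let $d_i,h_i:C_i\to C_{i+1}$ be the sums of all $d_{\alpha,\beta}$, respectively $h_{\alpha,\beta}$, over edges $\alpha\to\beta$ with $w(\alpha)=i+n_-$ and $w(\beta)=i+1+n_-$. **Bar-Natan complex.** $\mathcal{C}_{BN}(L)=(C_*[H],\,d_*+Hh_* )$, a complex of $\mathbb{F}_2[H]$-modules (the differential squares to zero and raises the homological degree $i$ by $1$). **Reduced complexes.** Fix a basepoint on $L$ away from the double points and keep its position in each $D_\alpha(L)$; the circle containing it is the basepoint circle. Let $\mathcal{C}_x$ and $\mathcal{C}_1$ be the $\mathbb{F}_2[H]$-submodules of $\mathcal{C}_{BN}$ spanned by the labellings in which the basepoint circle is labelled $\boldsymbol{x}$ and $\boldsymbol{1}$, respectively. $\mathcal{C}_x$ is a subcomplex of $\mathcal{C}_{BN}$. As a module $\mathcal{C}_1$ is identified with the quotient $\mathcal{C}_{BN}/\mathcal{C}_x$ and it is given the quotient differential, i.e. $d+Hh$ followed by the projection $\mathcal{C}_{BN}\to\mathcal{C}_{BN}/\mathcal{C}_x\cong\mathcal{C}_1$. *)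

theory Defs
  imports
    "HOL-Algebra.Module"
    "HOL-Algebra.AbelCoset"
    "HOL-Algebra.Algebraic_Closure_Type"
    "HOL-Computational_Algebra.Polynomial"
    "HOL-Library.FuncSet"
    "HOL-Library.Function_Algebras"
    "HOL-Library.Z2"
begin

section \<open>Modules and cochain complexes\<close>

text \<open>The fields \<open>mult\<close> and \<open>one\<close> of the record type \<^type>\<open>module\<close> are inherited from rings and play
  no role for modules.\<close>

definition free_module :: "'g set \<Rightarrow> ('r::comm_ring_1, 'g \<Rightarrow> 'r) module" where
  "free_module S =
     \<lparr>carrier = {f. \<forall>g. g \<notin> S \<longrightarrow> f g = 0}, monoid.mult = undefined, one = undefined,
      zero = (\<lambda>g. 0), add = (\<lambda>f f' g. f g + f' g), module.smult = (\<lambda>r f g. r * f g)\<rparr>"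

text \<open>In the quotient, the scalar multiple of a coset is the union of the cosets \<open>N + r a\<close> and not
  just the set of the elements \<open>r a\<close>, which need not be a whole coset.\<close>

definition quotient_module :: "('r, 'm) module \<Rightarrow> 'm set \<Rightarrow> ('r, 'm set) module" where
  "quotient_module M N =
     \<lparr>carrier = a_rcosets\<^bsub>M\<^esub> N, monoid.mult = undefined, one = undefined,
      zero = N, add = (\<lambda>A B. A <+>\<^bsub>M\<^esub> B),
      module.smult = (\<lambda>r A. \<Union>a\<in>A. N +>\<^bsub>M\<^esub> (r \<odot>\<^bsub>M\<^esub> a))\<rparr>"

definition direct_sum_module ::
    "('r, 'm) module \<Rightarrow> ('r, 'n) module \<Rightarrow> ('r, 'm \<times> 'n) module" where
  "direct_sum_module M N =
     \<lparr>carrier = carrier M \<times> carrier N, monoid.mult = undefined, one = undefined,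
      zero = (\<zero>\<^bsub>M\<^esub>, \<zero>\<^bsub>N\<^esub>),
      add = (\<lambda>(x, y) (x', y'). (x \<oplus>\<^bsub>M\<^esub> x', y \<oplus>\<^bsub>N\<^esub> y')),
      module.smult = (\<lambda>r (x, y). (r \<odot>\<^bsub>M\<^esub> x, r \<odot>\<^bsub>N\<^esub> y))\<rparr>"

definition module_isomorphic ::
    "('r, 'k) ring_scheme \<Rightarrow> ('r, 'm) module \<Rightarrow> ('r, 'n) module \<Rightarrow> bool" where
  "module_isomorphic R M N \<longleftrightarrow>
     (\<exists>\<phi>. bij_betw \<phi> (carrier M) (carrier N) \<and>
          (\<forall>x\<in>carrier M. \<forall>y\<in>carrier M. \<phi> (x \<oplus>\<^bsub>M\<^esub> y) = \<phi> x \<oplus>\<^bsub>N\<^esub> \<phi> y) \<and>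
          (\<forall>r\<in>carrier R. \<forall>x\<in>carrier M. \<phi> (r \<odot>\<^bsub>M\<^esub> x) = r \<odot>\<^bsub>N\<^esub> \<phi> x))"

record ('r, 'm) cochain_complex =
  chain_module :: "int \<Rightarrow> ('r, 'm) module"
  differential :: "int \<Rightarrow> 'm \<Rightarrow> 'm"

definition cocycles :: "('r, 'm) cochain_complex \<Rightarrow> int \<Rightarrow> 'm set" where
  "cocycles C i =
     {z \<in> carrier (chain_module C i). differential C i z = \<zero>\<^bsub>chain_module C (i + 1)\<^esub>}"

definition coboundaries :: "('r, 'm) cochain_complex \<Rightarrow> int \<Rightarrow> 'm set" where
  "coboundaries C i = differential C (i - 1) ` carrier (chain_module C (i - 1))"

definition homology :: "('r, 'm) cochain_complex \<Rightarrow> int \<Rightarrow> ('r, 'm set) module" where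
  "homology C i =
     quotient_module (chain_module C i \<lparr>carrier := cocycles C i\<rparr>) (coboundaries C i)"


section \<open>Oriented link diagrams in the plane\<close>

text \<open>
  A diagram is encoded by its planar diagram code. The crossings are \<open>0, \<dots>, n - 1\<close>. The double
  points cut the link projection into arcs; a component without crossings is a single arc, which
  ends at no crossing. At each crossing \<open>c\<close> the four ends of arcs are numbered \<open>0, 1, 2, 3\<close>
  counterclockwise, starting with the incoming end of the understrand, so that the understrand runs
  from end \<open>0\<close> to end \<open>2\<close>, and \<open>arc_at D c k\<close> is the arc to which end \<open>k\<close> belongs. The overstrand
  runs from end \<open>3\<close> to end \<open>1\<close> at a positive crossing and from end \<open>1\<close> to end \<open>3\<close> at a negative one.
\<close>

record 'a diagram =
  ncrossings :: nat
  positive :: "nat \<Rightarrow> bool"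
  arcs :: "'a set"
  arc_at :: "nat \<Rightarrow> nat \<Rightarrow> 'a"

definition darts :: "'a diagram \<Rightarrow> (nat \<times> nat) set" where
  "darts D = {..<ncrossings D} \<times> {..<4}"

definition incoming :: "'a diagram \<Rightarrow> (nat \<times> nat) set" where
  "incoming D = {(c, k) \<in> darts D. k = 0 \<or> k = (if positive D c then 3 else 1)}"

definition outgoing :: "'a diagram \<Rightarrow> (nat \<times> nat) set" where
  "outgoing D = {(c, k) \<in> darts D. k = 2 \<or> k = (if positive D c then 1 else 3)}"

definition dart_arc :: "'a diagram \<Rightarrow> nat \<times> nat \<Rightarrow> 'a" where
  "dart_arc D = (\<lambda>(c, k). arc_at D c k)"

definition closure_classes :: "'b set \<Rightarrow> ('b \<Rightarrow> 'b \<Rightarrow> bool) \<Rightarrow> 'b set set" where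
  "closure_classes A r = (\<lambda>x. {y \<in> A. equivclp r x y}) ` A"

text \<open>The dart \<open>(c, k)\<close> also stands for the corner at \<open>c\<close> between the ends \<open>k\<close> and \<open>k + 1\<close>. Two corners
  are related if they lie on the same side (to the left, seen from \<open>c\<close>) of the same arc.\<close>

definition corner_adj :: "'a diagram \<Rightarrow> nat \<times> nat \<Rightarrow> nat \<times> nat \<Rightarrow> bool" where
  "corner_adj D = (\<lambda>(c, k) (c', l). (c, k) \<in> darts D \<and>
     (\<exists>k'. (c', k') \<in> darts D \<and> (c', k') \<noteq> (c, k) \<and> arc_at D c' k' = arc_at D c k \<and>
       l = (k' + 3) mod 4))"

definition crossing_adj :: "'a diagram \<Rightarrow> nat \<Rightarrow> nat \<Rightarrow> bool" where
  "crossing_adj D c c' \<longleftrightarrow>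
     (\<exists>k k'. (c, k) \<in> darts D \<and> (c', k') \<in> darts D \<and> arc_at D c k = arc_at D c' k')"

text \<open>Planarity of the 4-valent graph formed by the crossings, with the given cyclic orders:
  every connected component has genus \<open>0\<close>. As \<open>V - E + F \<le> 2\<close> for each component, with faces counted
  component by component, it suffices to require equality for the sum over all components.\<close>

definition planar :: "'a diagram \<Rightarrow> bool" where
  "planar D \<longleftrightarrow>
     ncrossings D + card (closure_classes (darts D) (corner_adj D)) =
     card (dart_arc D ` darts D) + 2 * card (closure_classes {..<ncrossings D} (crossing_adj D))"

definition oriented_link_diagram :: "'a diagram \<Rightarrow> bool" where
  "oriented_link_diagram D \<longleftrightarrow>
     finite (arcs D) \<and>
     dart_arc D ` darts D \<subseteq> arcs D \<and>
     inj_on (dart_arc D) (incoming D) \<and>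
     inj_on (dart_arc D) (outgoing D) \<and>
     dart_arc D ` incoming D = dart_arc D ` outgoing D \<and>
     planar D"

definition nminus :: "'a diagram \<Rightarrow> nat" where
  "nminus D = card {c. c < ncrossings D \<and> \<not> positive D c}"


section \<open>Resolutions\<close>

text \<open>A vertex \<open>\<alpha>\<close> of the cube is represented by the set of crossings with \<open>\<alpha>\<^sub>j = 1\<close>. Rotating the
  overstrand (ends \<open>1\<close> and \<open>3\<close>) counterclockwise sweeps out the corners between the ends \<open>1, 2\<close> and
  between the ends \<open>3, 0\<close>; joining these corners connects end \<open>0\<close> with \<open>1\<close> and end \<open>2\<close> with \<open>3\<close>.\<close>

definition joined :: "'a diagram \<Rightarrow> nat set \<Rightarrow> 'a \<Rightarrow> 'a \<Rightarrow> bool" where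
  "joined D \<alpha> a b \<longleftrightarrow>
     (\<exists>c<ncrossings D. \<exists>(k, l) \<in> (if c \<in> \<alpha> then {(0, 3), (1, 2)} else {(0, 1), (2, 3)}).
        a = arc_at D c k \<and> b = arc_at D c l)"

text \<open>A circle of a resolution is represented by the set of the arcs of \<open>D\<close> which it contains.\<close>

definition circles :: "'a diagram \<Rightarrow> nat set \<Rightarrow> 'a set set" where
  "circles D \<alpha> = closure_classes (arcs D) (joined D \<alpha>)"

definition circle_of :: "'a diagram \<Rightarrow> nat set \<Rightarrow> 'a \<Rightarrow> 'a set" where
  "circle_of D \<alpha> a = {b \<in> arcs D. equivclp (joined D \<alpha>) a b}"


section \<open>The Bar-Natan complex\<close>

datatype label = L1 | LX

text \<open>\<open>label \<Rightarrow> bit\<close> is \<open>W\<close>, and \<open>label \<times> label \<Rightarrow> bit\<close> is \<open>W \<otimes> W\<close>; the bilinear maps \<open>m, m'\<close> and the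
  linear maps \<open>\<Delta>, \<Delta>'\<close> are given by their values on basis vectors.\<close>

definition basis_vec :: "'b \<Rightarrow> 'b \<Rightarrow> bit" where
  "basis_vec u = (\<lambda>v. if v = u then 1 else 0)"

fun m_map :: "label \<Rightarrow> label \<Rightarrow> label \<Rightarrow> bit" where
  "m_map L1 L1 = basis_vec L1"
| "m_map L1 LX = basis_vec LX"
| "m_map LX L1 = basis_vec LX"
| "m_map LX LX = 0"

fun Delta_map :: "label \<Rightarrow> label \<times> label \<Rightarrow> bit" where
  "Delta_map L1 = basis_vec (L1, LX) + basis_vec (LX, L1)"
| "Delta_map LX = basis_vec (LX, LX)"

fun m'_map :: "label \<Rightarrow> label \<Rightarrow> label \<Rightarrow> bit" where
  "m'_map LX LX = basis_vec LX"
| "m'_map _ _ = 0"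

fun Delta'_map :: "label \<Rightarrow> label \<times> label \<Rightarrow> bit" where
  "Delta'_map L1 = basis_vec (L1, L1)"
| "Delta'_map LX = 0"

text \<open>The matrix entry, at the labellings \<open>l\<close> of \<open>D\<^sub>\<alpha>\<close> and \<open>l'\<close> of \<open>D\<^sub>\<beta>\<close>, of the edge map from \<open>\<alpha>\<close> to
  \<open>\<beta> = insert j \<alpha>\<close> which is \<open>\<mu>\<close> for a merge and \<open>\<delta>\<close> for a split. In each of the two resolutions of
  the crossing \<open>j\<close>, the ends \<open>0\<close> and \<open>2\<close> belong to different strands, so the circles through these two
  ends are exactly the circles involved. The last case does not occur for planar diagrams.\<close>

definition edge_entry ::
    "(label \<Rightarrow> label \<Rightarrow> label \<Rightarrow> bit) \<Rightarrow> (label \<Rightarrow> label \<times> label \<Rightarrow> bit) \<Rightarrow> 'a diagram \<Rightarrow>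
      nat set \<Rightarrow> nat \<Rightarrow> ('a set \<Rightarrow> label) \<Rightarrow> ('a set \<Rightarrow> label) \<Rightarrow> bit" where
  "edge_entry \<mu> \<delta> D \<alpha> j l l' =
     (let \<beta> = insert j \<alpha>;
          P = circle_of D \<alpha> (arc_at D j 0); Q = circle_of D \<alpha> (arc_at D j 2);
          P' = circle_of D \<beta> (arc_at D j 0); Q' = circle_of D \<beta> (arc_at D j 2)
      in if \<exists>c \<in> circles D \<alpha> - {P, Q}. l' c \<noteq> l c then 0
         else if P \<noteq> Q \<and> P' = Q' then \<mu> (l P) (l Q) (l' P')
         else if P = Q \<and> P' \<noteq> Q' then \<delta> (l P) (l' P', l' Q')
         else 0)"

type_synonym 'a gen = "nat set \<times> ('a set \<Rightarrow> label)"

definition gens :: "'a diagram \<Rightarrow> int \<Rightarrow> 'a gen set" where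
  "gens D i =
     {(\<alpha>, l). \<alpha> \<subseteq> {..<ncrossings D} \<and> int (card \<alpha>) = i + int (nminus D) \<and>
              l \<in> circles D \<alpha> \<rightarrow>\<^sub>E UNIV}"

definition cube_entry ::
    "(label \<Rightarrow> label \<Rightarrow> label \<Rightarrow> bit) \<Rightarrow> (label \<Rightarrow> label \<times> label \<Rightarrow> bit) \<Rightarrow> 'a diagram \<Rightarrow>
      'a gen \<Rightarrow> 'a gen \<Rightarrow> bit" where
  "cube_entry \<mu> \<delta> D = (\<lambda>(\<alpha>, l) (\<beta>, l').
     \<Sum>j \<in> {j. j < ncrossings D \<and> j \<notin> \<alpha> \<and> \<beta> = insert j \<alpha>}. edge_entry \<mu> \<delta> D \<alpha> j l l')"

definition d_entry :: "'a diagram \<Rightarrow> 'a gen \<Rightarrow> 'a gen \<Rightarrow> bit" where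
  "d_entry = cube_entry m_map Delta_map"

definition h_entry :: "'a diagram \<Rightarrow> 'a gen \<Rightarrow> 'a gen \<Rightarrow> bit" where
  "h_entry = cube_entry m'_map Delta'_map"

definition H_var :: "bit poly" where
  "H_var = monom 1 1"

text \<open>The differential \<open>d\<^sub>i + H h\<^sub>i\<close>. The module \<open>C\<^sub>i[H]\<close> is the free module over the polynomial ring
  on the finite set of labelled resolutions in degree \<open>i\<close>.\<close>

definition BN_diff :: "'a diagram \<Rightarrow> int \<Rightarrow> ('a gen \<Rightarrow> bit poly) \<Rightarrow> ('a gen \<Rightarrow> bit poly)" where
  "BN_diff D i f = (\<lambda>g'. if g' \<in> gens D (i + 1)
     then \<Sum>g \<in> gens D i. ([:d_entry D g g':] + H_var * [:h_entry D g g':]) * f g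
     else 0)"

definition BN_complex :: "'a diagram \<Rightarrow> (bit poly, 'a gen \<Rightarrow> bit poly) cochain_complex" where
  "BN_complex D =
     \<lparr>chain_module = (\<lambda>i. free_module (gens D i)), differential = BN_diff D\<rparr>"


section \<open>The reduced complexes\<close>

text \<open>The basepoint is given by the arc \<open>p\<close> on which it lies.\<close>

definition based_gens :: "label \<Rightarrow> 'a diagram \<Rightarrow> 'a \<Rightarrow> int \<Rightarrow> 'a gen set" where
  "based_gens v D p i = {(\<alpha>, l) \<in> gens D i. l (circle_of D \<alpha> p) = v}"

definition Cx_complex :: "'a diagram \<Rightarrow> 'a \<Rightarrow> (bit poly, 'a gen \<Rightarrow> bit poly) cochain_complex" where
  "Cx_complex D p =
     \<lparr>chain_module = (\<lambda>i. free_module (based_gens LX D p i)), differential = BN_diff D\<rparr>"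

text \<open>The projection with kernel the subcomplex \<open>C\<^sub>x\<close> deletes the components at labellings with label
  \<open>x\<close> at the basepoint.\<close>

definition proj_C1 ::
    "'a diagram \<Rightarrow> 'a \<Rightarrow> int \<Rightarrow> ('a gen \<Rightarrow> bit poly) \<Rightarrow> ('a gen \<Rightarrow> bit poly)" where
  "proj_C1 D p i f = (\<lambda>g. if g \<in> based_gens L1 D p i then f g else 0)"

definition C1_complex :: "'a diagram \<Rightarrow> 'a \<Rightarrow> (bit poly, 'a gen \<Rightarrow> bit poly) cochain_complex" where
  "C1_complex D p =
     \<lparr>chain_module = (\<lambda>i. free_module (based_gens L1 D p i)),
      differential = (\<lambda>i f. proj_C1 D p (i + 1) (BN_diff D i f))\<rparr>"

end

theory Submission
  imports Defs
begin

text \<open>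
  With coefficients deformed by \<open>H\<close>, the label space \<open>W\<close> becomes the Frobenius algebra
  \<open>F[H][x] / (x\<^sup>2 = H x)\<close> over the field \<open>F\<close> with two elements, and the edge maps of the Bar-Natan
  complex \<open>C\<close> are its product and its coproduct. The sequence \<open>0 \<rightarrow> C\<^sub>x \<rightarrow> C \<rightarrow> C\<^sub>1 \<rightarrow> 0\<close> splits already on the
  level of complexes, and the point is to find a chain map \<open>r\<close> from \<open>C\<close> to \<open>C\<^sub>x\<close> that is the identity on
  \<open>C\<^sub>x\<close>.

  The algebra has an automorphism \<open>\<sigma>\<close> with \<open>\<sigma> x = x + H\<close>, which respects the coproduct too. Applied to
  all circles at once it is a chain automorphism of \<open>C\<close>. The multiplication \<open>X\<close> by \<open>x\<close> on the
  basepoint circle is a chain map as well, with image in \<open>C\<^sub>x\<close>. As \<open>\<sigma>\<close> is the identity modulo \<open>H\<close>, the chain map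
  \<open>X \<sigma> - X\<close> is divisible by \<open>H\<close>, and the quotient \<open>r = (X \<sigma> - X) / H\<close> is again a chain map with image
  in \<open>C\<^sub>x\<close>. On \<open>C\<^sub>x\<close> the map \<open>X \<sigma>\<close> vanishes, since \<open>x \<sigma>(x) = x (x + H) = 2 H x = 0\<close>, while \<open>X\<close> is
  multiplication by \<open>H\<close>, since \<open>x\<^sup>2 = H x\<close>; hence \<open>r\<close> is \<open>-1 = 1\<close> there
  (\<open>retraction_entry_from_x\<close>). For \<open>H = 0\<close> the map \<open>r\<close> becomes \<open>X\<close> after
  Shumakovitch's derivation, the sum over all circles of replacing a label \<open>x\<close> by \<open>1\<close>, which splits
  Khovanov homology over \<open>F\<close>.

  Together with the projection onto \<open>C\<^sub>1\<close>, the map \<open>r\<close> is an isomorphism of complexes from \<open>C\<close> onto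
  \<open>C\<^sub>x \<oplus> C\<^sub>1\<close> (\<open>retraction_proj_bij\<close>), and \<open>homology_of_direct_sum\<close> passes to homology.

  In matrix terms \<open>X\<close> and \<open>X \<sigma>\<close> are tensor products over the circles of a resolution, with one factor for
  the basepoint circle and another one for all other circles. That they are chain maps
  (\<open>tensor_entry_commutes\<close>) reduces to two facts: along an edge of the cube all circles but those
  merged or split are unchanged (\<open>circles_of_connected_resolution\<close>), and the factors are compatible with
  the product and the coproduct (\<open>linear_pair_x\<close>, \<open>linear_pair_x_shift\<close>), a finite check.
\<close>


section \<open>Homology of a direct sum of complexes\<close>

definition linear_map ::
    "('r, 'k) ring_scheme \<Rightarrow> ('r, 'm) module \<Rightarrow> ('r, 'n) module \<Rightarrow> ('m \<Rightarrow> 'n) \<Rightarrow> bool" where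
  "linear_map R M N f \<longleftrightarrow>
     f \<in> carrier M \<rightarrow> carrier N \<and>
     (\<forall>x\<in>carrier M. \<forall>y\<in>carrier M. f (x \<oplus>\<^bsub>M\<^esub> y) = f x \<oplus>\<^bsub>N\<^esub> f y) \<and>
     (\<forall>r\<in>carrier R. \<forall>x\<in>carrier M. f (r \<odot>\<^bsub>M\<^esub> x) = r \<odot>\<^bsub>N\<^esub> f x)"

lemma linear_mapD:
  assumes "linear_map R M N f"
  shows "x \<in> carrier M \<Longrightarrow> f x \<in> carrier N"
    and "x \<in> carrier M \<Longrightarrow> y \<in> carrier M \<Longrightarrow> f (x \<oplus>\<^bsub>M\<^esub> y) = f x \<oplus>\<^bsub>N\<^esub> f y"
    and "r \<in> carrier R \<Longrightarrow> x \<in> carrier M \<Longrightarrow> f (r \<odot>\<^bsub>M\<^esub> x) = r \<odot>\<^bsub>N\<^esub> f x"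
  using assms unfolding linear_map_def by auto

lemma linear_map_zero:
  assumes "module R M" "module R N" "linear_map R M N f"
  shows "f \<zero>\<^bsub>M\<^esub> = \<zero>\<^bsub>N\<^esub>"
proof -
  interpret M: module R M by fact
  interpret N: module R N by fact
  have "f \<zero>\<^bsub>M\<^esub> \<oplus>\<^bsub>N\<^esub> f \<zero>\<^bsub>M\<^esub> = f \<zero>\<^bsub>M\<^esub>"
    using linear_mapD(2)[OF assms(3) M.zero_closed M.zero_closed] by simp
  thus ?thesis
    using linear_mapD(1)[OF assms(3) M.zero_closed] by simp
qed

lemma image_coset:
  assumes "linear_map R M N f" "K \<subseteq> carrier M" "z \<in> carrier M"
  shows "f ` (K +>\<^bsub>M\<^esub> z) = f ` K +>\<^bsub>N\<^esub> f z"
  using assms linear_mapD(2)[OF assms(1)]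
  unfolding a_r_coset_def' by (auto simp: subset_iff image_iff)

lemma image_set_add:
  assumes "linear_map R M N f" "K \<subseteq> carrier M" "L \<subseteq> carrier M"
  shows "f ` (K <+>\<^bsub>M\<^esub> L) = f ` K <+>\<^bsub>N\<^esub> f ` L"
  using assms linear_mapD(2)[OF assms(1)]
  unfolding set_add_def' by (auto simp: subset_iff image_UN)

lemma quotient_smult_image:
  assumes "module R M" "linear_map R M N f" "K \<subseteq> carrier M" "L \<subseteq> carrier M" "r \<in> carrier R"
  shows "f ` (\<Union>a\<in>L. K +>\<^bsub>M\<^esub> (r \<odot>\<^bsub>M\<^esub> a)) = (\<Union>b\<in>f ` L. f ` K +>\<^bsub>N\<^esub> (r \<odot>\<^bsub>N\<^esub> b))"
proof -
  interpret M: module R M by fact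
  have "f ` (K +>\<^bsub>M\<^esub> (r \<odot>\<^bsub>M\<^esub> a)) = f ` K +>\<^bsub>N\<^esub> (r \<odot>\<^bsub>N\<^esub> f a)" if "a \<in> L" for a
    using that assms image_coset[OF assms(2,3), of "r \<odot>\<^bsub>M\<^esub> a"] linear_mapD(3)[OF assms(2)]
    by (auto simp: subset_iff)
  thus ?thesis by (auto simp: image_UN)
qed

lemma homology_simps:
  "carrier (homology C i) =
     (\<lambda>z. coboundaries C i +>\<^bsub>chain_module C i\<^esub> z) ` cocycles C i"
  "U \<oplus>\<^bsub>homology C i\<^esub> V = U <+>\<^bsub>chain_module C i\<^esub> V"
  "r \<odot>\<^bsub>homology C i\<^esub> U =
     (\<Union>a\<in>U. coboundaries C i +>\<^bsub>chain_module C i\<^esub> (r \<odot>\<^bsub>chain_module C i\<^esub> a))"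
  unfolding homology_def quotient_module_def A_RCOSETS_def' a_r_coset_def' set_add_def'
  by auto

text \<open>The isomorphism sends a class to the pair of its images under \<open>f\<close> and \<open>g\<close>. Taking images of cosets
commutes with the operations of the quotient modules as soon as \<open>f\<close> and \<open>g\<close> map the coboundaries of
\<open>C\<close> onto those of \<open>A\<close> and \<open>B\<close>; this holds because \<open>(f, g)\<close> is onto one degree below.\<close>

lemma homology_of_direct_sum:
  fixes C :: "('r, 'm) cochain_complex"
    and A :: "('r, 'a) cochain_complex" and B :: "('r, 'b) cochain_complex"
  assumes modC: "\<And>i. module R (chain_module C i)"
    and modA: "\<And>i. module R (chain_module A i)"
    and modB: "\<And>i. module R (chain_module B i)"
    and dC: "\<And>i x. x \<in> carrier (chain_module C i) \<Longrightarrow>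
               differential C i x \<in> carrier (chain_module C (i + 1))"
    and f: "\<And>i. linear_map R (chain_module C i) (chain_module A i) (f i)"
    and g: "\<And>i. linear_map R (chain_module C i) (chain_module B i) (g i)"
    and fd: "\<And>i x. x \<in> carrier (chain_module C i) \<Longrightarrow>
               f (i + 1) (differential C i x) = differential A i (f i x)"
    and gd: "\<And>i x. x \<in> carrier (chain_module C i) \<Longrightarrow>
               g (i + 1) (differential C i x) = differential B i (g i x)"
    and bij: "\<And>i. bij_betw (\<lambda>x. (f i x, g i x)) (carrier (chain_module C i))
               (carrier (chain_module A i) \<times> carrier (chain_module B i))"
  shows "module_isomorphic R (homology C i) (direct_sum_module (homology A i) (homology B i))"
proof -
  let ?M = "chain_module C i" and ?P = "chain_module A i" and ?Q = "chain_module B i"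
  let ?K = "coboundaries C i"
  have zero_closed: "\<zero>\<^bsub>chain_module C j\<^esub> \<in> carrier (chain_module C j)" for j
  proof -
    interpret module R "chain_module C j" by (rule modC)
    show ?thesis by simp
  qed
  have inj: "x = y" if "x \<in> carrier (chain_module C j)" "y \<in> carrier (chain_module C j)"
      "f j x = f j y" "g j x = g j y" for x y j
    using bij[of j] that unfolding bij_betw_def inj_on_def by blast
  have surj: "\<exists>x\<in>carrier (chain_module C j). f j x = a \<and> g j x = b"
    if "a \<in> carrier (chain_module A j)" "b \<in> carrier (chain_module B j)" for a b j
  proof -
    have "(a, b) \<in> (\<lambda>x. (f j x, g j x)) ` carrier (chain_module C j)"
      using bij[of j] that unfolding bij_betw_def by auto
    thus ?thesis by auto
  qed
  have K: "?K \<subseteq> carrier ?M"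
    using dC[of _ "i - 1"] unfolding coboundaries_def by auto
  have K_prod: "(\<lambda>x. (f i x, g i x)) ` ?K = coboundaries A i \<times> coboundaries B i"
  proof (intro equalityI subsetI)
    fix p assume "p \<in> (\<lambda>x. (f i x, g i x)) ` ?K"
    thus "p \<in> coboundaries A i \<times> coboundaries B i"
      using fd[of _ "i - 1"] gd[of _ "i - 1"] linear_mapD(1)[OF f] linear_mapD(1)[OF g]
      unfolding coboundaries_def by auto
  next
    fix p assume "p \<in> coboundaries A i \<times> coboundaries B i"
    then obtain a b where "a \<in> carrier (chain_module A (i - 1))"
      "b \<in> carrier (chain_module B (i - 1))"
      and p: "p = (differential A (i - 1) a, differential B (i - 1) b)"
      unfolding coboundaries_def by auto
    with surj obtain x where "x \<in> carrier (chain_module C (i - 1))"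
      "f (i - 1) x = a" "g (i - 1) x = b" by blast
    thus "p \<in> (\<lambda>x. (f i x, g i x)) ` ?K"
      using fd[of x "i - 1"] gd[of x "i - 1"] unfolding p coboundaries_def image_image
      by (auto intro!: image_eqI[of _ _ x])
  qed
  have "differential C (i - 1) \<zero>\<^bsub>chain_module C (i - 1)\<^esub> \<in> ?K"
    unfolding coboundaries_def using zero_closed by (rule imageI)
  hence "?K \<noteq> {}" by auto
  hence "coboundaries A i \<noteq> {}" "coboundaries B i \<noteq> {}"
    using K_prod by auto
  hence fK: "f i ` ?K = coboundaries A i" and gK: "g i ` ?K = coboundaries B i"
    using arg_cong[OF K_prod, of "image fst"] arg_cong[OF K_prod, of "image snd"]
    by (auto simp: image_image)
  have zeros: "f j \<zero>\<^bsub>chain_module C j\<^esub> = \<zero>\<^bsub>chain_module A j\<^esub>"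
    "g j \<zero>\<^bsub>chain_module C j\<^esub> = \<zero>\<^bsub>chain_module B j\<^esub>" for j
    using linear_map_zero[OF modC modA f] linear_map_zero[OF modC modB g] by auto
  have cocycles_iff: "x \<in> cocycles C i \<longleftrightarrow> f i x \<in> cocycles A i \<and> g i x \<in> cocycles B i"
    if "x \<in> carrier ?M" for x
  proof -
    have "differential C i x = \<zero>\<^bsub>chain_module C (i + 1)\<^esub> \<longleftrightarrow>
        f (i + 1) (differential C i x) = \<zero>\<^bsub>chain_module A (i + 1)\<^esub> \<and>
        g (i + 1) (differential C i x) = \<zero>\<^bsub>chain_module B (i + 1)\<^esub>"
      using inj[OF dC[OF that] zero_closed] zeros by auto
    thus ?thesis
      using that fd gd linear_mapD(1)[OF f] linear_mapD(1)[OF g]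
      unfolding cocycles_def by auto
  qed
  have Z: "cocycles C i \<subseteq> carrier ?M" "cocycles A i \<subseteq> carrier ?P" "cocycles B i \<subseteq> carrier ?Q"
    unfolding cocycles_def by auto
  have sub: "U \<subseteq> carrier ?M" if "U \<in> carrier (homology C i)" for U
  proof -
    interpret module R ?M by (rule modC)
    show ?thesis
      using that Z(1) K unfolding homology_simps a_r_coset_def' by (auto simp: subset_iff)
  qed
  define \<Phi> where "\<Phi> U = (f i ` U, g i ` U)" for U
  have \<Phi>_coset: "\<Phi> (?K +>\<^bsub>?M\<^esub> z) = (coboundaries A i +>\<^bsub>?P\<^esub> f i z, coboundaries B i +>\<^bsub>?Q\<^esub> g i z)"
    if "z \<in> carrier ?M" for z
    unfolding \<Phi>_def using image_coset[OF f K that] image_coset[OF g K that] fK gK by simp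
  \<comment> \<open>A coset is recovered from its two images, because the image of the coboundaries of \<open>C\<close> in the
    direct sum is the whole product of the coboundaries and not a smaller set with the same
    projections.\<close>
  have coset_prod: "(\<lambda>x. (f i x, g i x)) ` U = f i ` U \<times> g i ` U"
    if U: "U \<in> carrier (homology C i)" for U
  proof -
    obtain z where z: "z \<in> carrier ?M" "U = ?K +>\<^bsub>?M\<^esub> z"
      using U Z(1) unfolding homology_simps by auto
    have "(\<lambda>x. (f i x, g i x)) ` U = (\<lambda>(a, b). (a \<oplus>\<^bsub>?P\<^esub> f i z, b \<oplus>\<^bsub>?Q\<^esub> g i z)) `
        ((\<lambda>x. (f i x, g i x)) ` ?K)"
      using K z linear_mapD(2)[OF f] linear_mapD(2)[OF g]
      unfolding a_r_coset_def' by (auto simp: image_iff subset_iff)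
    also have "\<dots> = (coboundaries A i +>\<^bsub>?P\<^esub> f i z) \<times> (coboundaries B i +>\<^bsub>?Q\<^esub> g i z)"
      unfolding K_prod a_r_coset_def' by auto
    also have "\<dots> = f i ` U \<times> g i ` U"
      using \<Phi>_coset[OF z(1)] z(2) unfolding \<Phi>_def by simp
    finally show ?thesis .
  qed
  have "inj_on \<Phi> (carrier (homology C i))"
  proof (rule inj_onI)
    fix U V assume UV: "U \<in> carrier (homology C i)" "V \<in> carrier (homology C i)" "\<Phi> U = \<Phi> V"
    hence "(\<lambda>x. (f i x, g i x)) ` U = (\<lambda>x. (f i x, g i x)) ` V"
      using coset_prod unfolding \<Phi>_def by simp
    thus "U = V"
      using inj_on_image_eq_iff[OF bij_betw_imp_inj_on[OF bij] sub sub, OF UV(1,2)] by simp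
  qed
  moreover have "\<Phi> ` carrier (homology C i) = carrier (homology A i) \<times> carrier (homology B i)"
  proof (intro equalityI subsetI)
    fix p assume "p \<in> \<Phi> ` carrier (homology C i)"
    then obtain z where z: "z \<in> cocycles C i" "p = \<Phi> (?K +>\<^bsub>?M\<^esub> z)"
      unfolding homology_simps by auto
    hence "z \<in> carrier ?M" using Z by auto
    thus "p \<in> carrier (homology A i) \<times> carrier (homology B i)"
      using z(1) cocycles_iff[of z] unfolding z(2) homology_simps by (simp add: \<Phi>_coset)
  next
    fix p assume "p \<in> carrier (homology A i) \<times> carrier (homology B i)"
    then obtain a b where ab: "a \<in> cocycles A i" "b \<in> cocycles B i"
      and p: "p = (coboundaries A i +>\<^bsub>?P\<^esub> a, coboundaries B i +>\<^bsub>?Q\<^esub> b)"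
      unfolding homology_simps by auto
    then obtain z where z: "z \<in> carrier ?M" "f i z = a" "g i z = b"
      using surj Z by blast
    hence "p = \<Phi> (?K +>\<^bsub>?M\<^esub> z)" "z \<in> cocycles C i"
      using ab cocycles_iff[of z] p by (simp_all add: \<Phi>_coset)
    thus "p \<in> \<Phi> ` carrier (homology C i)"
      unfolding homology_simps by blast
  qed
  ultimately have "bij_betw \<Phi> (carrier (homology C i))
      (carrier (direct_sum_module (homology A i) (homology B i)))"
    unfolding bij_betw_def direct_sum_module_def by simp
  moreover have "\<Phi> (U \<oplus>\<^bsub>homology C i\<^esub> V) =
      \<Phi> U \<oplus>\<^bsub>direct_sum_module (homology A i) (homology B i)\<^esub> \<Phi> V"
    if "U \<in> carrier (homology C i)" "V \<in> carrier (homology C i)" for U V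
    using image_set_add[OF f sub sub, OF that] image_set_add[OF g sub sub, OF that]
    unfolding \<Phi>_def direct_sum_module_def by (simp add: homology_simps)
  moreover have "\<Phi> (r \<odot>\<^bsub>homology C i\<^esub> U) =
      r \<odot>\<^bsub>direct_sum_module (homology A i) (homology B i)\<^esub> \<Phi> U"
    if "r \<in> carrier R" "U \<in> carrier (homology C i)" for r U
    using quotient_smult_image[OF modC f K sub[OF that(2)] that(1)]
      quotient_smult_image[OF modC g K sub[OF that(2)] that(1)] fK gK
    unfolding \<Phi>_def direct_sum_module_def by (simp add: homology_simps)
  ultimately show ?thesis
    unfolding module_isomorphic_def by blast
qed


section \<open>Free modules and matrices\<close>

lemma module_free_module:
  "module (ring_of_type_algebra :: 'r::comm_ring_1 ring) (free_module S :: ('r, 'g \<Rightarrow> 'r) module)"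
proof (rule moduleI)
  show "cring (ring_of_type_algebra :: 'r ring)" by (rule cring_from_type_algebra)
  show "abelian_group (free_module S :: ('r, 'g \<Rightarrow> 'r) module)"
  proof (rule abelian_groupI)
    fix f :: "'g \<Rightarrow> 'r" assume "f \<in> carrier (free_module S)"
    thus "\<exists>f'\<in>carrier (free_module S). f' \<oplus>\<^bsub>free_module S\<^esub> f = \<zero>\<^bsub>free_module S\<^esub>"
      by (intro bexI[of _ "\<lambda>g. - f g"]) (auto simp: free_module_def)
  qed (auto simp: free_module_def algebra_simps)
qed (auto simp: free_module_def ring_of_type_algebra_def algebra_simps)

lemma free_module_outside: "f \<in> carrier (free_module S) \<Longrightarrow> g \<notin> S \<Longrightarrow> f g = 0"
  by (simp add: free_module_def)

text \<open>As in the Bar-Natan differential, the first index of a matrix is the source generator, so that a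
composition of maps corresponds to the product of the matrices in the order of application.\<close>

definition matrix_map :: "'g set \<Rightarrow> 'h set \<Rightarrow> ('g \<Rightarrow> 'h \<Rightarrow> 'r::comm_ring_1) \<Rightarrow> ('g \<Rightarrow> 'r) \<Rightarrow> 'h \<Rightarrow> 'r" where
  "matrix_map S T a f = (\<lambda>h. if h \<in> T then \<Sum>g\<in>S. a g h * f g else 0)"

lemma matrix_map_linear:
  "linear_map ring_of_type_algebra (free_module S') (free_module T) (matrix_map S T a)"
  unfolding linear_map_def free_module_def ring_of_type_algebra_def matrix_map_def
  by (auto simp: fun_eq_iff algebra_simps sum.distrib sum_distrib_left)

lemma matrix_map_comp:
  "matrix_map T U b (matrix_map S T a f) = matrix_map S U (\<lambda>g u. \<Sum>h\<in>T. a g h * b h u) f"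
proof (rule ext)
  fix u
  have "(\<Sum>h\<in>T. b h u * (\<Sum>g\<in>S. a g h * f g)) = (\<Sum>h\<in>T. \<Sum>g\<in>S. a g h * b h u * f g)"
    by (simp add: sum_distrib_left mult_ac)
  also have "\<dots> = (\<Sum>g\<in>S. \<Sum>h\<in>T. a g h * b h u * f g)"
    by (rule sum.swap)
  finally show "matrix_map T U b (matrix_map S T a f) u =
      matrix_map S U (\<lambda>g u. \<Sum>h\<in>T. a g h * b h u) f u"
    by (simp add: matrix_map_def sum_distrib_right)
qed

lemma matrix_map_cong:
  assumes "\<And>g h. g \<in> S \<Longrightarrow> h \<in> T \<Longrightarrow> a g h = b g h"
  shows "matrix_map S T a f = matrix_map S T b f"
  using assms by (auto simp: matrix_map_def fun_eq_iff intro!: sum.cong)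


section \<open>Circles before and after changing one resolution\<close>

text \<open>A merge seen from the relations: if \<open>\<rho>\<close> and \<open>\<rho>'\<close> differ only within a set \<open>T\<close> that lies in a single
class of \<open>\<rho>'\<close> and is covered by the classes of \<open>s\<close> and \<open>s'\<close> for \<open>\<rho>\<close>, then \<open>\<rho>'\<close> identifies these two
classes and does nothing else.\<close>

lemma equivclp_surgery:
  assumes \<rho>: "\<And>x y. \<rho> x y \<Longrightarrow> \<rho>' x y \<or> x \<in> T \<and> y \<in> T"
    and \<rho>': "\<And>x y. \<rho>' x y \<Longrightarrow> \<rho> x y \<or> x \<in> T \<and> y \<in> T"
    and T: "\<And>t. t \<in> T \<Longrightarrow> equivclp \<rho> s t \<or> equivclp \<rho> s' t"
    and T': "\<And>t. t \<in> T \<Longrightarrow> equivclp \<rho>' s t"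
    and s': "s' \<in> T"
  shows "equivclp \<rho>' x (y :: 'a) \<longleftrightarrow> equivclp \<rho> x y \<or>
           (equivclp \<rho> s x \<or> equivclp \<rho> s' x) \<and> (equivclp \<rho> s y \<or> equivclp \<rho> s' y)"
proof -
  have tr: "equivclp r x y \<Longrightarrow> equivclp r y z \<Longrightarrow> equivclp r x z" for r :: "'a \<Rightarrow> 'a \<Rightarrow> bool" and x y z
    by (rule equivclp_trans)
  have sy: "equivclp r x y \<Longrightarrow> equivclp r y x" for r :: "'a \<Rightarrow> 'a \<Rightarrow> bool" and x y
    by (rule equivclp_sym)
  have le: "equivclp \<rho>' x y" if "equivclp \<rho> x y" for x y
    using that
  proof (induction rule: equivclp_induct)
    case (step y z)
    hence "\<rho>' y z \<or> \<rho>' z y \<or> y \<in> T \<and> z \<in> T"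
      using \<rho>[of y z] \<rho>[of z y] by auto
    hence "equivclp \<rho>' y z"
      using tr[OF sy[OF T'] T', of y z] by auto
    thus ?case using step.IH by (rule tr[rotated])
  qed simp
  have touched: "equivclp \<rho>' s x" if "equivclp \<rho> s x \<or> equivclp \<rho> s' x" for x
    using that le[of s x] le[of s' x] tr[OF T'[OF s'], of x] by auto
  show ?thesis
  proof
    assume "equivclp \<rho>' x y"
    thus "equivclp \<rho> x y \<or>
        (equivclp \<rho> s x \<or> equivclp \<rho> s' x) \<and> (equivclp \<rho> s y \<or> equivclp \<rho> s' y)"
    proof (induction rule: equivclp_induct)
      case (step y z)
      hence "\<rho> y z \<or> \<rho> z y \<or> y \<in> T \<and> z \<in> T"
        using \<rho>'[of y z] \<rho>'[of z y] by auto
      thus ?case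
      proof (elim disjE)
        assume "y \<in> T \<and> z \<in> T"
        thus ?thesis
          using step.IH T[of y] T[of z] tr[of \<rho> s y x] tr[of \<rho> s' y x] sy[of \<rho> x y] by auto
      qed (use step.IH tr[of \<rho> x y z] tr[of \<rho> s y z] tr[of \<rho> s' y z] in auto)
    qed simp
  next
    assume "equivclp \<rho> x y \<or>
        (equivclp \<rho> s x \<or> equivclp \<rho> s' x) \<and> (equivclp \<rho> s y \<or> equivclp \<rho> s' y)"
    thus "equivclp \<rho>' x y"
      using le[of x y] tr[OF sy[OF touched] touched, of x y] by auto
  qed
qed

lemma joined_change_one:
  assumes "\<alpha> - {j} = \<gamma> - {j}" "joined D \<gamma> x y"
  shows "joined D \<alpha> x y \<or> x \<in> arc_at D j ` {..<4} \<and> y \<in> arc_at D j ` {..<4}"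
proof -
  obtain c k l where c: "c < ncrossings D"
    "(k, l) \<in> (if c \<in> \<gamma> then {(0, 3), (1, 2)} else {(0, 1), (2, 3)})"
    "x = arc_at D c k" "y = arc_at D c l"
    using assms(2) unfolding joined_def by blast
  show ?thesis
  proof (cases "c = j")
    case True
    hence "k < 4 \<and> l < 4" using c(2) by (auto split: if_splits)
    thus ?thesis using c True by auto
  next
    case False
    hence "c \<in> \<gamma> \<longleftrightarrow> c \<in> \<alpha>" using assms(1) by auto
    thus ?thesis using c unfolding joined_def by auto
  qed
qed

lemma end_joined_to_strand:
  assumes "j < ncrossings D" "k < 4"
  shows "equivclp (joined D \<alpha>) (arc_at D j 0) (arc_at D j k) \<or>
         equivclp (joined D \<alpha>) (arc_at D j 2) (arc_at D j k)"
proof -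
  have J: "joined D \<alpha> (arc_at D j a) (arc_at D j b)"
    if "(a, b) \<in> (if j \<in> \<alpha> then {(0, 3), (1, 2)} else {(0, 1), (2, 3)})" for a b
    using that assms(1) unfolding joined_def by blast
  consider "k = 0" | "k = 1" | "k = 2" | "k = 3" using assms(2) by linarith
  thus ?thesis
  proof cases
    case 2
    thus ?thesis using J[of 1 2] J[of 0 1] by (cases "j \<in> \<alpha>") auto
  next
    case 4
    thus ?thesis using J[of 0 3] J[of 2 3] by (cases "j \<in> \<alpha>") auto
  qed auto
qed

locale based_diagram =
  fixes D :: "'a diagram" and p :: 'a
  assumes finite_arcs: "finite (arcs D)"
    and darts_arcs: "dart_arc D ` darts D \<subseteq> arcs D"
    and p: "p \<in> arcs D"
begin

lemma arc_at_in_arcs: "j < ncrossings D \<Longrightarrow> k < 4 \<Longrightarrow> arc_at D j k \<in> arcs D"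
  using darts_arcs by (auto simp: darts_def dart_arc_def image_subset_iff)

lemma finite_circles: "finite (circles D \<alpha>)"
  using finite_arcs by (simp add: circles_def closure_classes_def)

lemma circle_of_in_circles: "a \<in> arcs D \<Longrightarrow> circle_of D \<alpha> a \<in> circles D \<alpha>"
  by (auto simp: circles_def closure_classes_def circle_of_def)

lemma circles_eq: "circles D \<alpha> = circle_of D \<alpha> ` arcs D"
  by (auto simp: circles_def closure_classes_def circle_of_def)

lemma circle_of_eq_iff:
  assumes "b \<in> arcs D"
  shows "circle_of D \<alpha> a = circle_of D \<alpha> b \<longleftrightarrow> equivclp (joined D \<alpha>) a b"
proof
  assume "circle_of D \<alpha> a = circle_of D \<alpha> b"
  hence "b \<in> circle_of D \<alpha> a" using assms by (simp add: circle_of_def)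
  thus "equivclp (joined D \<alpha>) a b" by (simp add: circle_of_def)
next
  assume "equivclp (joined D \<alpha>) a b"
  hence "equivclp (joined D \<alpha>) a x \<longleftrightarrow> equivclp (joined D \<alpha>) b x" for x
    by (meson equivclp_sym equivclp_trans)
  thus "circle_of D \<alpha> a = circle_of D \<alpha> b" by (simp add: circle_of_def)
qed

lemma circle_of_unique:
  assumes "c \<in> circles D \<alpha>" "a \<in> c"
  shows "c = circle_of D \<alpha> a"
proof -
  obtain b where "c = circle_of D \<alpha> b" using assms(1) unfolding circles_eq by auto
  moreover from this have "a \<in> arcs D" "equivclp (joined D \<alpha>) b a"
    using assms(2) by (auto simp: circle_of_def)
  ultimately show ?thesis by (simp add: circle_of_eq_iff)
qed

lemma mem_circle_of: "a \<in> arcs D \<Longrightarrow> a \<in> circle_of D \<alpha> a"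
  by (simp add: circle_of_def)

text \<open>Both the merge and the split follow from this lemma: \<open>\<gamma>\<close> is the vertex at which the two strands at
\<open>j\<close> lie on one circle, and \<open>\<alpha>\<close> is the other one. For a merge, \<open>\<gamma>\<close> is the end of the edge, and for a
split it is the start. All four ends at \<open>j\<close> lie on the circle \<open>S\<close> of \<open>\<gamma>\<close>, so the passage from \<open>\<alpha>\<close> to
\<open>\<gamma>\<close> joins \<open>P\<close> and \<open>Q\<close> and leaves every circle away from \<open>j\<close> alone.\<close>

lemma circles_of_connected_resolution:
  assumes j: "j < ncrossings D" and \<alpha>\<gamma>: "\<alpha> - {j} = \<gamma> - {j}"
    and P: "P = circle_of D \<alpha> (arc_at D j 0)" and Q: "Q = circle_of D \<alpha> (arc_at D j 2)"
    and S: "S = circle_of D \<gamma> (arc_at D j 0)" "S = circle_of D \<gamma> (arc_at D j 2)"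
  shows "S = P \<union> Q"
    and "circles D \<gamma> = insert S (circles D \<alpha> - {P, Q})"
    and "S \<notin> circles D \<alpha> - {P, Q}"
proof -
  let ?s = "arc_at D j 0" and ?s' = "arc_at D j 2"
  have arcs: "?s \<in> arcs D" "?s' \<in> arcs D" using arc_at_in_arcs j by auto
  have ss: "equivclp (joined D \<gamma>) ?s ?s'"
    using circle_of_eq_iff[OF arcs(2), of \<gamma> ?s] S(1)[symmetric] S(2)[symmetric] by simp
  have eq: "equivclp (joined D \<gamma>) x y \<longleftrightarrow> equivclp (joined D \<alpha>) x y \<or>
      (equivclp (joined D \<alpha>) ?s x \<or> equivclp (joined D \<alpha>) ?s' x) \<and>
      (equivclp (joined D \<alpha>) ?s y \<or> equivclp (joined D \<alpha>) ?s' y)" for x y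
  proof (rule equivclp_surgery[where T = "arc_at D j ` {..<4}"])
    show "joined D \<gamma> x y \<or> x \<in> arc_at D j ` {..<4} \<and> y \<in> arc_at D j ` {..<4}"
      if "joined D \<alpha> x y" for x y
      using joined_change_one[OF \<alpha>\<gamma>[symmetric] that] .
    show "joined D \<alpha> x y \<or> x \<in> arc_at D j ` {..<4} \<and> y \<in> arc_at D j ` {..<4}"
      if "joined D \<gamma> x y" for x y
      using joined_change_one[OF \<alpha>\<gamma> that] .
    show "equivclp (joined D \<alpha>) ?s t \<or> equivclp (joined D \<alpha>) ?s' t"
      if "t \<in> arc_at D j ` {..<4}" for t
      using that end_joined_to_strand[OF j, of _ \<alpha>] by auto
    show "equivclp (joined D \<gamma>) ?s t" if "t \<in> arc_at D j ` {..<4}" for t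
      using that end_joined_to_strand[OF j, of _ \<gamma>] equivclp_trans[OF ss] by auto
  qed auto
  show SPQ: "S = P \<union> Q"
    unfolding S(1) P Q circle_of_def using eq by auto
  have untouched: "circle_of D \<gamma> a = circle_of D \<alpha> a" if "a \<in> arcs D" "a \<notin> P" "a \<notin> Q" for a
    using that eq unfolding P Q circle_of_def by auto
  have touched: "circle_of D \<gamma> a = S" if "a \<in> S" for a
    using that circle_of_unique[of S \<gamma> a] circle_of_in_circles[OF arcs(1)] S(1) by auto
  have PQ: "circle_of D \<alpha> a \<in> {P, Q} \<longleftrightarrow> a \<in> S" if "a \<in> arcs D" for a
  proof
    assume "circle_of D \<alpha> a \<in> {P, Q}"
    thus "a \<in> S" using mem_circle_of[OF that, of \<alpha>] SPQ by auto
  next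
    assume "a \<in> S"
    thus "circle_of D \<alpha> a \<in> {P, Q}"
      using SPQ circle_of_unique[of P \<alpha> a] circle_of_unique[of Q \<alpha> a]
        circle_of_in_circles[OF arcs(1)] circle_of_in_circles[OF arcs(2)] P Q by auto
  qed
  have SsubA: "S \<subseteq> arcs D" unfolding S(1) circle_of_def by auto
  show "circles D \<gamma> = insert S (circles D \<alpha> - {P, Q})"
  proof (intro equalityI subsetI)
    fix c assume "c \<in> circles D \<gamma>"
    then obtain a where a: "a \<in> arcs D" "c = circle_of D \<gamma> a" unfolding circles_eq by auto
    show "c \<in> insert S (circles D \<alpha> - {P, Q})"
    proof (cases "a \<in> S")
      case False
      hence "c = circle_of D \<alpha> a" using untouched a SPQ by auto
      thus ?thesis using PQ[OF a(1)] False circle_of_in_circles[OF a(1)] by auto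
    qed (use a touched in auto)
  next
    fix c assume c: "c \<in> insert S (circles D \<alpha> - {P, Q})"
    show "c \<in> circles D \<gamma>"
    proof (cases "c = S")
      case True
      thus ?thesis using S(1) circle_of_in_circles[OF arcs(1)] by auto
    next
      case False
      then obtain a where a: "a \<in> arcs D" "c = circle_of D \<alpha> a" "c \<notin> {P, Q}"
        using c unfolding circles_eq by auto
      hence "c = circle_of D \<gamma> a" using untouched[of a] PQ[of a] SPQ by auto
      thus ?thesis using circle_of_in_circles[OF a(1)] by auto
    qed
  qed
  show "S \<notin> circles D \<alpha> - {P, Q}"
  proof
    assume "S \<in> circles D \<alpha> - {P, Q}"
    moreover have "?s \<in> S" using S(1) mem_circle_of[OF arcs(1)] by auto
    ultimately have "S = P" using circle_of_unique[of S \<alpha> ?s] P by auto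
    thus False using \<open>S \<in> circles D \<alpha> - {P, Q}\<close> by auto
  qed
qed

end


section \<open>Tensor products of linear maps on labels\<close>

lemma UNIV_label: "UNIV = {L1, LX}"
  using label.exhaust by auto

instance label :: finite
  by standard (simp add: UNIV_label)

lemma sum_label: "(\<Sum>u\<in>UNIV. f u) = f L1 + f LX" for f :: "label \<Rightarrow> 'b::comm_monoid_add"
  by (simp add: UNIV_label)

lemma all_label: "(\<forall>u. P u) \<longleftrightarrow> P L1 \<and> P LX"
  by (metis label.exhaust)

text \<open>The identity factors of an edge map force a summation variable to agree with a given labelling \<open>k\<close>
on the unchanged circles \<open>R\<close>; only the labels of the one or two circles involved remain to be summed
over.\<close>

lemma sum_extensional_1:
  fixes F :: "('c \<Rightarrow> label) \<Rightarrow> 'b::comm_monoid_add"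
  assumes "finite R" "P \<notin> R"
  shows "(\<Sum>l\<in>insert P R \<rightarrow>\<^sub>E UNIV. if \<forall>c\<in>R. l c = k c then F l else 0) =
         (\<Sum>u\<in>UNIV. F ((restrict k R)(P := u)))"
proof -
  have "{l \<in> insert P R \<rightarrow>\<^sub>E UNIV. \<forall>c\<in>R. l c = k c} = range (\<lambda>u. (restrict k R)(P := u))"
  proof (intro equalityI subsetI)
    fix l assume l: "l \<in> {l \<in> insert P R \<rightarrow>\<^sub>E UNIV. \<forall>c\<in>R. l c = k c}"
    hence "l = (restrict k R)(P := l P)"
      by (auto simp: fun_eq_iff PiE_def extensional_def)
    thus "l \<in> range (\<lambda>u. (restrict k R)(P := u))" by blast
  qed (use assms(2) in \<open>auto simp: PiE_def extensional_def\<close>)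
  moreover have "inj (\<lambda>u. (restrict k R)(P := u))"
    by (rule injI) (metis fun_upd_same)
  moreover have "finite (insert P R \<rightarrow>\<^sub>E (UNIV :: label set))"
    using assms(1) by (intro finite_PiE) auto
  ultimately show ?thesis
    by (simp add: sum.inter_filter[symmetric] sum.reindex)
qed

lemma sum_extensional_2:
  fixes F :: "('c \<Rightarrow> label) \<Rightarrow> 'b::comm_monoid_add"
  assumes "finite R" "P \<notin> R" "Q \<notin> R" "P \<noteq> Q"
  shows "(\<Sum>l\<in>insert P (insert Q R) \<rightarrow>\<^sub>E UNIV. if \<forall>c\<in>R. l c = k c then F l else 0) =
         (\<Sum>u\<in>UNIV. \<Sum>v\<in>UNIV. F ((restrict k R)(P := u, Q := v)))"
proof -
  have "{l \<in> insert P (insert Q R) \<rightarrow>\<^sub>E UNIV. \<forall>c\<in>R. l c = k c} =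
      range (\<lambda>(u, v). (restrict k R)(P := u, Q := v))"
  proof (intro equalityI subsetI)
    fix l assume l: "l \<in> {l \<in> insert P (insert Q R) \<rightarrow>\<^sub>E UNIV. \<forall>c\<in>R. l c = k c}"
    hence "l = (\<lambda>(u, v). (restrict k R)(P := u, Q := v)) (l P, l Q)"
      by (auto simp: fun_eq_iff PiE_def extensional_def)
    thus "l \<in> range (\<lambda>(u, v). (restrict k R)(P := u, Q := v))" by blast
  qed (use assms in \<open>auto simp: PiE_def extensional_def\<close>)
  moreover have "inj (\<lambda>(u, v). (restrict k R)(P := u, Q := v))"
  proof (rule injI)
    fix x y assume "(case x of (u, v) \<Rightarrow> (restrict k R)(P := u, Q := v)) =
      (case y of (u, v) \<Rightarrow> (restrict k R)(P := u, Q := v))"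
    from fun_cong[OF this, of P] fun_cong[OF this, of Q] show "x = y"
      using assms(4) by (auto split: prod.splits)
  qed
  moreover have "finite (insert P (insert Q R) \<rightarrow>\<^sub>E (UNIV :: label set))"
    using assms(1) by (intro finite_PiE) auto
  ultimately have "(\<Sum>l\<in>insert P (insert Q R) \<rightarrow>\<^sub>E UNIV. if \<forall>c\<in>R. l c = k c then F l else 0) =
      (\<Sum>(u, v)\<in>UNIV. F ((restrict k R)(P := u, Q := v)))"
    by (simp add: sum.inter_filter[symmetric] sum.reindex case_prod_unfold)
  thus ?thesis
    by (simp add: sum.cartesian_product)
qed

text \<open>The matrix entry of the tensor product over the circles \<open>c \<in> K\<close> of the endomorphisms of \<open>W\<close> with
matrices \<open>t c\<close>.\<close>

definition tensor :: "('c \<Rightarrow> label \<Rightarrow> label \<Rightarrow> 'r::comm_ring_1) \<Rightarrow> 'c set \<Rightarrow>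
    ('c \<Rightarrow> label) \<Rightarrow> ('c \<Rightarrow> label) \<Rightarrow> 'r" where
  "tensor t K l l' = (\<Prod>c\<in>K. t c (l c) (l' c))"

lemma tensor_insert:
  "finite R \<Longrightarrow> P \<notin> R \<Longrightarrow> tensor t (insert P R) l l' = t P (l P) (l' P) * tensor t R l l'"
  by (simp add: tensor_def)

lemma tensor_upd:
  "P \<notin> R \<Longrightarrow> tensor t R (l(P := u)) l' = tensor t R l l'"
  "P \<notin> R \<Longrightarrow> tensor t R l (l'(P := u)) = tensor t R l l'"
  "R \<subseteq> K \<Longrightarrow> tensor t R (restrict l K) l' = tensor t R l l'"
  "R \<subseteq> K \<Longrightarrow> tensor t R l (restrict l' K) = tensor t R l l'"
  unfolding tensor_def by (intro prod.cong; auto)+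

text \<open>The relations \<open>\<mu> \<circ> (a \<otimes> b) = c \<circ> \<mu>\<close> and \<open>\<delta> \<circ> a = (b \<otimes> c) \<circ> \<delta>\<close>, written in matrix entries.\<close>

definition commutes_with_mult where
  "commutes_with_mult \<mu> a b c \<longleftrightarrow> (\<forall>u v w.
     (\<Sum>u'\<in>UNIV. \<Sum>v'\<in>UNIV. a u u' * b v v' * \<mu> u' v' w) = (\<Sum>w'\<in>UNIV. \<mu> u v w' * c w' w))"
  for \<mu> :: "label \<Rightarrow> label \<Rightarrow> label \<Rightarrow> 'r::comm_ring_1"

definition commutes_with_comult where
  "commutes_with_comult \<delta> a b c \<longleftrightarrow> (\<forall>u v w.
     (\<Sum>u'\<in>UNIV. a u u' * \<delta> u' v w) = (\<Sum>v'\<in>UNIV. \<Sum>w'\<in>UNIV. \<delta> u v' w' * (b v' v * c w' w)))"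
  for \<delta> :: "label \<Rightarrow> label \<Rightarrow> label \<Rightarrow> 'r::comm_ring_1"

text \<open>On the unchanged circles \<open>R\<close> the edge map is the identity, so both composites have the factor
\<open>tensor t R l l''\<close>. What remains is the commutation of \<open>t\<close> with \<open>\<mu>\<close> on the circles involved.\<close>

lemma tensor_commutes_merge:
  fixes \<mu> :: "label \<Rightarrow> label \<Rightarrow> label \<Rightarrow> 'r::comm_ring_1"
  assumes R: "finite R" "P \<notin> R" "Q \<notin> R" "P \<noteq> Q" "S \<notin> R"
    and t: "commutes_with_mult \<mu> (t P) (t Q) (t S)"
  shows "(\<Sum>l'\<in>insert P (insert Q R) \<rightarrow>\<^sub>E UNIV. tensor t (insert P (insert Q R)) l l' *
            (if \<forall>c\<in>R. l'' c = l' c then \<mu> (l' P) (l' Q) (l'' S) else 0)) =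
         (\<Sum>l'\<in>insert S R \<rightarrow>\<^sub>E UNIV. (if \<forall>c\<in>R. l' c = l c then \<mu> (l P) (l Q) (l' S) else 0) *
            tensor t (insert S R) l' l'')"
    (is "?L = ?R")
proof -
  have "?L = (\<Sum>l'\<in>insert P (insert Q R) \<rightarrow>\<^sub>E UNIV. if \<forall>c\<in>R. l' c = l'' c
      then tensor t (insert P (insert Q R)) l l' * \<mu> (l' P) (l' Q) (l'' S) else 0)"
    by (intro sum.cong refl) auto
  also have "\<dots> = (\<Sum>u\<in>UNIV. \<Sum>v\<in>UNIV.
      tensor t R l l'' * (t P (l P) u * t Q (l Q) v * \<mu> u v (l'' S)))"
    using R by (simp add: sum_extensional_2 tensor_insert tensor_upd subset_insertI2 mult_ac)
  also have "\<dots> = tensor t R l l'' * (\<Sum>w\<in>UNIV. \<mu> (l P) (l Q) w * t S w (l'' S))"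
    using t unfolding commutes_with_mult_def by (simp add: sum_distrib_left[symmetric])
  also have "\<dots> = (\<Sum>w\<in>UNIV. \<mu> (l P) (l Q) w * (t S w (l'' S) * tensor t R l l''))"
    by (simp add: sum_distrib_left mult_ac)
  also have "\<dots> = (\<Sum>l'\<in>insert S R \<rightarrow>\<^sub>E UNIV. if \<forall>c\<in>R. l' c = l c
      then \<mu> (l P) (l Q) (l' S) * tensor t (insert S R) l' l'' else 0)"
    using R by (simp add: sum_extensional_1 tensor_insert tensor_upd subset_insertI2)
  also have "\<dots> = ?R"
    by (intro sum.cong refl) auto
  finally show ?thesis .
qed

lemma tensor_commutes_split:
  fixes \<delta> :: "label \<Rightarrow> label \<Rightarrow> label \<Rightarrow> 'r::comm_ring_1"
  assumes R: "finite R" "P \<notin> R" "Q \<notin> R" "P \<noteq> Q" "S \<notin> R"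
    and t: "commutes_with_comult \<delta> (t S) (t P) (t Q)"
  shows "(\<Sum>l'\<in>insert S R \<rightarrow>\<^sub>E UNIV. tensor t (insert S R) l l' *
            (if \<forall>c\<in>R. l'' c = l' c then \<delta> (l' S) (l'' P) (l'' Q) else 0)) =
         (\<Sum>l'\<in>insert P (insert Q R) \<rightarrow>\<^sub>E UNIV.
            (if \<forall>c\<in>R. l' c = l c then \<delta> (l S) (l' P) (l' Q) else 0) *
            tensor t (insert P (insert Q R)) l' l'')"
    (is "?L = ?R")
proof -
  have "?L = (\<Sum>l'\<in>insert S R \<rightarrow>\<^sub>E UNIV. if \<forall>c\<in>R. l' c = l'' c
      then tensor t (insert S R) l l' * \<delta> (l' S) (l'' P) (l'' Q) else 0)"
    by (intro sum.cong refl) auto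
  also have "\<dots> = (\<Sum>u\<in>UNIV. tensor t R l l'' * (t S (l S) u * \<delta> u (l'' P) (l'' Q)))"
    using R by (simp add: sum_extensional_1 tensor_insert tensor_upd subset_insertI2 mult_ac)
  also have "\<dots> = tensor t R l l'' *
      (\<Sum>u\<in>UNIV. \<Sum>v\<in>UNIV. \<delta> (l S) u v * (t P u (l'' P) * t Q v (l'' Q)))"
    using t unfolding commutes_with_comult_def by (simp add: sum_distrib_left[symmetric])
  also have "\<dots> = (\<Sum>u\<in>UNIV. \<Sum>v\<in>UNIV.
      \<delta> (l S) u v * (t P u (l'' P) * (t Q v (l'' Q) * tensor t R l l'')))"
    by (simp add: sum_distrib_left mult_ac)
  also have "\<dots> = (\<Sum>l'\<in>insert P (insert Q R) \<rightarrow>\<^sub>E UNIV. if \<forall>c\<in>R. l' c = l c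
      then \<delta> (l S) (l' P) (l' Q) * tensor t (insert P (insert Q R)) l' l'' else 0)"
    using R by (simp add: sum_extensional_2 tensor_insert tensor_upd subset_insertI2)
  also have "\<dots> = ?R"
    by (intro sum.cong refl) auto
  finally show ?thesis .
qed


section \<open>Symmetries of the Frobenius algebra\<close>

text \<open>The maps \<open>m + H m'\<close> and \<open>\<Delta> + H \<Delta>'\<close> are the product and the coproduct of the Frobenius algebra \<open>F[H][x] / (x\<^sup>2 = H x)\<close> over
the field \<open>F\<close> with two elements.\<close>

definition mult_coeff :: "label \<Rightarrow> label \<Rightarrow> label \<Rightarrow> bit poly" where
  "mult_coeff u v w = [:m_map u v w:] + H_var * [:m'_map u v w:]"

definition comult_coeff :: "label \<Rightarrow> label \<Rightarrow> label \<Rightarrow> bit poly" where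
  "comult_coeff u v w = [:Delta_map u (v, w):] + H_var * [:Delta'_map u (v, w):]"

lemma mult_coeff_simps [simp]:
  "mult_coeff L1 v w = (if v = w then 1 else 0)"
  "mult_coeff LX L1 w = (if w = LX then 1 else 0)"
  "mult_coeff LX LX w = (if w = LX then H_var else 0)"
  unfolding mult_coeff_def by (cases v; cases w; simp add: basis_vec_def one_pCons)+

lemma comult_coeff_simps [simp]:
  "comult_coeff L1 v w = (if v = L1 \<and> w = L1 then H_var else if v \<noteq> w then 1 else 0)"
  "comult_coeff LX v w = (if v = LX \<and> w = LX then 1 else 0)"
  unfolding comult_coeff_def by (cases v; cases w; simp add: basis_vec_def one_pCons)+

definition id_coeff :: "label \<Rightarrow> label \<Rightarrow> bit poly" where
  "id_coeff u v = (if u = v then 1 else 0)"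

text \<open>The matrix of the algebra automorphism \<open>\<sigma>\<close> with \<open>\<sigma> x = x + H\<close>. It respects the relation
\<open>x\<^sup>2 = H x\<close> because \<open>(x + H)\<^sup>2 = H x + H\<^sup>2 = H (x + H)\<close> in characteristic \<open>2\<close>.\<close>

fun shift_coeff :: "label \<Rightarrow> label \<Rightarrow> bit poly" where
  "shift_coeff L1 v = (if v = L1 then 1 else 0)"
| "shift_coeff LX v = (if v = LX then 1 else H_var)"

definition x_coeff :: "label \<Rightarrow> label \<Rightarrow> bit poly" where
  "x_coeff = mult_coeff LX"

definition x_shift_coeff :: "label \<Rightarrow> label \<Rightarrow> bit poly" where
  "x_shift_coeff u v = (\<Sum>w\<in>UNIV. shift_coeff u w * x_coeff w v)"

lemma bit_poly_two [simp]: "(2 :: bit poly) = 0"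
  by (simp add: numeral_poly)

lemma bit_poly_add_self: "a + a = 0" for a :: "bit poly"
  by (simp flip: mult_2)

text \<open>The decisive vanishing: \<open>x \<sigma>(x) = x (x + H) = 2 H x = 0\<close>.\<close>

lemma x_shift_coeff_eq: "x_shift_coeff u v = (if u = L1 \<and> v = LX then 1 else 0)"
  by (cases u) (auto simp: x_shift_coeff_def x_coeff_def sum_label bit_poly_add_self)

text \<open>Let \<open>a\<close> act on the circles without and \<open>b\<close> on the circle with the basepoint. These are the conditions
for such an operator to commute with all edge maps: the basepoint lies on neither circle involved in
a merge or split, on the first, or on the second.\<close>

definition linear_pair :: "(label \<Rightarrow> label \<Rightarrow> bit poly) \<Rightarrow> (label \<Rightarrow> label \<Rightarrow> bit poly) \<Rightarrow> bool" where
  "linear_pair a b \<longleftrightarrow>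
     commutes_with_mult mult_coeff a a a \<and> commutes_with_mult mult_coeff b a b \<and>
     commutes_with_mult mult_coeff a b b \<and>
     commutes_with_comult comult_coeff a a a \<and> commutes_with_comult comult_coeff b b a \<and>
     commutes_with_comult comult_coeff b a b"

text \<open>Product and coproduct are maps of bimodules over the algebra, so multiplication by \<open>x\<close> can be moved
through them from the old to the new basepoint circle.\<close>

lemma linear_pair_x: "linear_pair id_coeff x_coeff"
  unfolding linear_pair_def commutes_with_mult_def commutes_with_comult_def all_label sum_label
    id_coeff_def x_coeff_def
  by (simp add: bit_poly_add_self)

text \<open>The automorphism \<open>\<sigma>\<close> preserves the product and also the coproduct, since
\<open>\<Delta>(x + H) = (x + H) \<otimes> (x + H)\<close> and \<open>(\<sigma> \<otimes> \<sigma>) \<Delta>(1) = \<Delta>(1) + 2 H (1 \<otimes> 1)\<close> for the deformed coproduct.\<close>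

lemma linear_pair_x_shift: "linear_pair shift_coeff x_shift_coeff"
  unfolding linear_pair_def commutes_with_mult_def commutes_with_comult_def all_label sum_label
    x_shift_coeff_eq
  by (simp add: bit_poly_add_self algebra_simps)


section \<open>Tensor operators on the cube\<close>

definition edge_coeff ::
    "'a diagram \<Rightarrow> nat set \<Rightarrow> nat \<Rightarrow> ('a set \<Rightarrow> label) \<Rightarrow> ('a set \<Rightarrow> label) \<Rightarrow> bit poly" where
  "edge_coeff D \<alpha> j l l' =
     [:edge_entry m_map Delta_map D \<alpha> j l l':] + H_var * [:edge_entry m'_map Delta'_map D \<alpha> j l l':]"

definition BN_coeff :: "'a diagram \<Rightarrow> 'a gen \<Rightarrow> 'a gen \<Rightarrow> bit poly" where
  "BN_coeff D g g' = [:d_entry D g g':] + H_var * [:h_entry D g g':]"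

lemma BN_diff_eq_matrix_map: "BN_diff D i = matrix_map (gens D i) (gens D (i + 1)) (BN_coeff D)"
  by (simp add: fun_eq_iff BN_diff_def matrix_map_def BN_coeff_def)

lemma BN_coeff_eq:
  "BN_coeff D (\<alpha>, l) (\<beta>, l') =
     (\<Sum>j\<in>{j. j < ncrossings D \<and> j \<notin> \<alpha> \<and> \<beta> = insert j \<alpha>}. edge_coeff D \<alpha> j l l')"
proof -
  have const: "(\<Sum>j\<in>J. [:F j:]) = [:\<Sum>j\<in>J. F j:]" for F :: "nat \<Rightarrow> bit" and J
    by (induction J rule: infinite_finite_induct) auto
  show ?thesis
    unfolding BN_coeff_def d_entry_def h_entry_def cube_entry_def edge_coeff_def
    by (simp add: const[symmetric] sum.distrib sum_distrib_left del: mult_pCons_right)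
qed

definition based :: "'a \<Rightarrow> (label \<Rightarrow> label \<Rightarrow> bit poly) \<Rightarrow> (label \<Rightarrow> label \<Rightarrow> bit poly) \<Rightarrow>
    'a set \<Rightarrow> label \<Rightarrow> label \<Rightarrow> bit poly" where
  "based p a b c = (if p \<in> c then b else a)"

definition tensor_entry :: "('a set \<Rightarrow> label \<Rightarrow> label \<Rightarrow> bit poly) \<Rightarrow> 'a diagram \<Rightarrow>
    'a gen \<Rightarrow> 'a gen \<Rightarrow> bit poly" where
  "tensor_entry t D = (\<lambda>(\<alpha>, l) (\<beta>, l'). if \<alpha> = \<beta> then tensor t (circles D \<alpha>) l l' else 0)"

context based_diagram
begin

text \<open>A merge or split at \<open>j\<close> is a merge or split of the circles through the two strands at \<open>j\<close>, and the
basepoint lies on the larger circle if and only if it lies on exactly one of the two smaller ones.\<close>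

lemma edge_square:
  assumes j: "j < ncrossings D" "j \<notin> \<alpha>" and ab: "linear_pair a b"
  defines "t \<equiv> based p a b" and "\<beta> \<equiv> insert j \<alpha>"
  shows "(\<Sum>l'\<in>circles D \<alpha> \<rightarrow>\<^sub>E UNIV. tensor t (circles D \<alpha>) l l' * edge_coeff D \<alpha> j l' l'') =
         (\<Sum>l'\<in>circles D \<beta> \<rightarrow>\<^sub>E UNIV. edge_coeff D \<alpha> j l l' * tensor t (circles D \<beta>) l' l'')"
proof -
  define P where "P = circle_of D \<alpha> (arc_at D j 0)"
  define Q where "Q = circle_of D \<alpha> (arc_at D j 2)"
  define P' where "P' = circle_of D \<beta> (arc_at D j 0)"
  define Q' where "Q' = circle_of D \<beta> (arc_at D j 2)"
  note defs = P_def Q_def P'_def Q'_def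
  have arcs: "arc_at D j 0 \<in> arcs D" "arc_at D j 2 \<in> arcs D" using arc_at_in_arcs j by auto
  have disj: "c = c'" if "c \<in> circles D \<gamma>" "c' \<in> circles D \<gamma>" "p \<in> c" "p \<in> c'" for c c' \<gamma>
    using circle_of_unique that by metis
  have in\<alpha>: "P \<in> circles D \<alpha>" "Q \<in> circles D \<alpha>" and in\<beta>: "P' \<in> circles D \<beta>" "Q' \<in> circles D \<beta>"
    unfolding defs using arcs circle_of_in_circles by auto
  have diff: "\<alpha> - {j} = \<beta> - {j}" unfolding \<beta>_def by auto
  consider (merge) "P \<noteq> Q" "P' = Q'" | (split) "P = Q" "P' \<noteq> Q'" | (none) "(P = Q) = (P' = Q')"
    by blast
  thus ?thesis
  proof cases
    case merge
    define R where "R = circles D \<alpha> - {P, Q}"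
    have S: "P' = P \<union> Q" "circles D \<beta> = insert P' R" "P' \<notin> R"
      unfolding R_def using circles_of_connected_resolution[OF j(1) diff P_def Q_def P'_def] merge(2)
      by (auto simp: Q'_def)
    have C: "circles D \<alpha> = insert P (insert Q R)"
      unfolding R_def using in\<alpha> by auto
    have R: "finite R" "P \<notin> R" "Q \<notin> R" unfolding R_def using finite_circles by auto
    have E: "edge_coeff D \<alpha> j l l' =
        (if \<forall>c\<in>R. l' c = l c then mult_coeff (l P) (l Q) (l' P') else 0)" for l l'
      using merge
      unfolding edge_coeff_def edge_entry_def Let_def mult_coeff_def \<beta>_def[symmetric] defs[symmetric] R_def[symmetric]
      by auto
    have "\<not> (p \<in> P \<and> p \<in> Q)" using disj in\<alpha> merge by blast
    hence "commutes_with_mult mult_coeff (t P) (t Q) (t P')"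
      using ab unfolding linear_pair_def t_def based_def S(1) by auto
    from tensor_commutes_merge[OF R merge(1) S(3) this]
    show ?thesis unfolding C S(2) E .
  next
    case split
    define R where "R = circles D \<beta> - {P', Q'}"
    have S: "P = P' \<union> Q'" "circles D \<alpha> = insert P R" "P \<notin> R"
      unfolding R_def using circles_of_connected_resolution[OF j(1) diff[symmetric] P'_def Q'_def P_def] split(1)
      by (auto simp: Q_def)
    have C: "circles D \<beta> = insert P' (insert Q' R)"
      unfolding R_def using in\<beta> by auto
    have R: "finite R" "P' \<notin> R" "Q' \<notin> R" unfolding R_def using finite_circles by auto
    have "circles D \<alpha> - {P, Q} = R" using S split by auto
    hence E: "edge_coeff D \<alpha> j l l' =
        (if \<forall>c\<in>R. l' c = l c then comult_coeff (l P) (l' P') (l' Q') else 0)" for l l'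
      using split
      unfolding edge_coeff_def edge_entry_def Let_def comult_coeff_def \<beta>_def[symmetric] defs[symmetric]
      by auto
    have "\<not> (p \<in> P' \<and> p \<in> Q')" using disj in\<beta> split by blast
    hence "commutes_with_comult comult_coeff (t P) (t P') (t Q')"
      using ab unfolding linear_pair_def t_def based_def S(1) by auto
    from tensor_commutes_split[OF R split(2) S(3) this]
    show ?thesis unfolding C S(2) E .
  next
    case none
    hence "edge_coeff D \<alpha> j l l' = 0" for l l'
      unfolding edge_coeff_def edge_entry_def Let_def \<beta>_def[symmetric] defs[symmetric] by auto
    thus ?thesis by simp
  qed
qed

lemma finite_gens: "finite (gens D i)"
proof (rule finite_subset)
  show "gens D i \<subseteq> (SIGMA \<alpha>:Pow {..<ncrossings D}. circles D \<alpha> \<rightarrow>\<^sub>E UNIV)"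
    unfolding gens_def by auto
  show "finite (SIGMA \<alpha>:Pow {..<ncrossings D}. circles D \<alpha> \<rightarrow>\<^sub>E (UNIV :: label set))"
    using finite_circles by (intro finite_SigmaI finite_PiE) auto
qed

lemma sum_gens_vertex:
  assumes "(\<alpha>, l) \<in> gens D i"
  shows "(\<Sum>h\<in>gens D i. if fst h = \<alpha> then F h else 0) =
         (\<Sum>l'\<in>circles D \<alpha> \<rightarrow>\<^sub>E UNIV. F (\<alpha>, l'))"
proof -
  have "{h \<in> gens D i. fst h = \<alpha>} = Pair \<alpha> ` (circles D \<alpha> \<rightarrow>\<^sub>E UNIV)"
    using assms unfolding gens_def by auto
  moreover have "inj_on (Pair \<alpha>) (circles D \<alpha> \<rightarrow>\<^sub>E (UNIV :: label set))"
    by (rule inj_onI) auto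
  ultimately show ?thesis
    by (simp add: sum.inter_filter[OF finite_gens, symmetric] sum.reindex)
qed

lemma tensor_entry_commutes:
  assumes "linear_pair a b" and g: "g \<in> gens D i" and g': "g' \<in> gens D (i + 1)"
  shows "(\<Sum>h\<in>gens D i. tensor_entry (based p a b) D g h * BN_coeff D h g') =
         (\<Sum>h\<in>gens D (i + 1). BN_coeff D g h * tensor_entry (based p a b) D h g')"
proof -
  let ?t = "based p a b"
  obtain \<alpha> l \<beta> l'' where gg: "g = (\<alpha>, l)" "g' = (\<beta>, l'')" by (cases g; cases g')
  let ?J = "{j. j < ncrossings D \<and> j \<notin> \<alpha> \<and> \<beta> = insert j \<alpha>}"
  have "(\<Sum>h\<in>gens D i. tensor_entry ?t D g h * BN_coeff D h g') =
      (\<Sum>h\<in>gens D i. if fst h = \<alpha> then tensor ?t (circles D \<alpha>) l (snd h) * BN_coeff D h g' else 0)"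
    by (intro sum.cong refl) (auto simp: tensor_entry_def gg split: prod.splits)
  also have "\<dots> = (\<Sum>l'\<in>circles D \<alpha> \<rightarrow>\<^sub>E UNIV. \<Sum>j\<in>?J.
      tensor ?t (circles D \<alpha>) l l' * edge_coeff D \<alpha> j l' l'')"
    using g unfolding gg by (simp add: sum_gens_vertex BN_coeff_eq sum_distrib_left)
  also have "\<dots> = (\<Sum>j\<in>?J. \<Sum>l'\<in>circles D \<alpha> \<rightarrow>\<^sub>E UNIV.
      tensor ?t (circles D \<alpha>) l l' * edge_coeff D \<alpha> j l' l'')"
    by (rule sum.swap)
  also have "\<dots> = (\<Sum>j\<in>?J. \<Sum>l'\<in>circles D \<beta> \<rightarrow>\<^sub>E UNIV.
      edge_coeff D \<alpha> j l l' * tensor ?t (circles D \<beta>) l' l'')"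
  proof (rule sum.cong[OF refl])
    fix j assume "j \<in> ?J"
    hence "j < ncrossings D" "j \<notin> \<alpha>" and \<beta>: "\<beta> = insert j \<alpha>" by auto
    from edge_square[OF this(1,2) assms(1)]
    show "(\<Sum>l'\<in>circles D \<alpha> \<rightarrow>\<^sub>E UNIV. tensor ?t (circles D \<alpha>) l l' * edge_coeff D \<alpha> j l' l'') =
        (\<Sum>l'\<in>circles D \<beta> \<rightarrow>\<^sub>E UNIV. edge_coeff D \<alpha> j l l' * tensor ?t (circles D \<beta>) l' l'')"
      unfolding \<beta> .
  qed
  also have "\<dots> = (\<Sum>l'\<in>circles D \<beta> \<rightarrow>\<^sub>E UNIV. \<Sum>j\<in>?J.
      edge_coeff D \<alpha> j l l' * tensor ?t (circles D \<beta>) l' l'')"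
    by (rule sum.swap)
  also have "\<dots> = (\<Sum>h\<in>gens D (i + 1). if fst h = \<beta>
      then BN_coeff D g h * tensor ?t (circles D \<beta>) (snd h) l'' else 0)"
    using g' unfolding gg by (simp add: sum_gens_vertex BN_coeff_eq sum_distrib_right)
  also have "\<dots> = (\<Sum>h\<in>gens D (i + 1). BN_coeff D g h * tensor_entry ?t D h g')"
    by (intro sum.cong refl) (auto simp: tensor_entry_def gg split: prod.splits)
  finally show ?thesis .
qed


section \<open>The retraction onto the reduced subcomplex\<close>

abbreviation x_entry :: "'a gen \<Rightarrow> 'a gen \<Rightarrow> bit poly" where
  "x_entry \<equiv> tensor_entry (based p id_coeff x_coeff) D"

abbreviation x_shift_entry :: "'a gen \<Rightarrow> 'a gen \<Rightarrow> bit poly" where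
  "x_shift_entry \<equiv> tensor_entry (based p shift_coeff x_shift_coeff) D"

text \<open>Write \<open>X\<close> for the multiplication by \<open>x\<close> at the basepoint and \<open>\<sigma>\<close> for the automorphism applied to all
circles. Modulo \<open>H\<close> the automorphism is the identity, so \<open>X \<sigma> - X\<close> can be divided by \<open>H\<close>.\<close>

definition retraction_entry :: "'a gen \<Rightarrow> 'a gen \<Rightarrow> bit poly" where
  "retraction_entry g g' = (x_shift_entry g g' - x_entry g g') div H_var"

lemma H_var_nonzero: "H_var \<noteq> 0"
  by (simp add: H_var_def)

lemma H_var_dvd_iff: "H_var dvd q \<longleftrightarrow> poly q 0 = 0"
  using poly_eq_0_iff_dvd[of q 0] by (simp add: H_var_def monom_altdef)

lemma H_retraction_entry: "H_var * retraction_entry g g' = x_shift_entry g g' - x_entry g g'"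
proof -
  have "poly (based p shift_coeff x_shift_coeff c u v) 0 = poly (based p id_coeff x_coeff c u v) 0"
    for c u v
    by (cases u; cases v)
      (auto simp: based_def x_shift_coeff_eq x_coeff_def id_coeff_def H_var_def poly_monom)
  hence "poly (x_shift_entry g g' - x_entry g g') 0 = 0"
    unfolding tensor_entry_def tensor_def by (auto simp: poly_prod split: prod.splits)
  thus ?thesis
    unfolding retraction_entry_def using H_var_dvd_iff by (simp add: dvd_mult_div_cancel)
qed

text \<open>The basepoint lies on exactly one circle, whose factor can be taken out.\<close>

lemma tensor_based_split:
  "tensor (based p a b) (circles D \<alpha>) l l' =
     b (l (circle_of D \<alpha> p)) (l' (circle_of D \<alpha> p)) *
     tensor (\<lambda>_. a) (circles D \<alpha> - {circle_of D \<alpha> p}) l l'"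
proof -
  have "tensor (based p a b) (circles D \<alpha> - {circle_of D \<alpha> p}) l l' =
      tensor (\<lambda>_. a) (circles D \<alpha> - {circle_of D \<alpha> p}) l l'"
    unfolding tensor_def based_def using circle_of_unique by (intro prod.cong refl) auto
  thus ?thesis
    using tensor_insert[of "circles D \<alpha> - {circle_of D \<alpha> p}" "circle_of D \<alpha> p" "based p a b" l l']
      finite_circles[of \<alpha>] circle_of_in_circles[OF p, of \<alpha>] mem_circle_of[OF p, of \<alpha>]
    by (simp add: insert_absorb based_def)
qed

lemma tensor_id:
  assumes "finite K"
  shows "tensor (\<lambda>_. id_coeff) (K - {c}) l l' = (if \<forall>c'\<in>K - {c}. l c' = l' c' then 1 else 0)"
  using assms by (auto simp: tensor_def id_coeff_def intro!: prod.neutral prod_zero)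

text \<open>In \<open>W\<close> the multiples of \<open>x\<close> are the multiples of the basis vector \<open>LX\<close>, so the images of \<open>X\<close> and
\<open>X \<sigma>\<close> lie in the reduced subcomplex.\<close>

lemma entries_not_x:
  assumes "g' \<in> gens D i" "g' \<notin> based_gens LX D p i"
  shows "x_entry g g' = 0" "x_shift_entry g g' = 0"
  using assms unfolding based_gens_def tensor_entry_def
  by (auto simp: tensor_based_split x_shift_coeff_eq x_coeff_def split: prod.splits)
    (metis label.exhaust mult_coeff_simps)+

text \<open>On the reduced subcomplex \<open>X\<close> is multiplication by \<open>H\<close>, because \<open>x\<^sup>2 = H x\<close>, and \<open>X \<sigma>\<close> vanishes,
because \<open>x \<sigma>(x) = 0\<close>.\<close>

lemma entries_from_x:
  assumes "g \<in> based_gens LX D p i" "g' \<in> gens D i"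
  shows "x_entry g g' = (if g' = g then H_var else 0)" "x_shift_entry g g' = 0"
proof -
  obtain \<alpha> l \<beta> l' where gg: "g = (\<alpha>, l)" "g' = (\<beta>, l')" by (cases g; cases g')
  let ?c = "circle_of D \<alpha> p"
  have l: "l ?c = LX" and ext: "l \<in> extensional (circles D \<alpha>)" "l' \<in> extensional (circles D \<beta>)"
    using assms unfolding gg based_gens_def gens_def by (auto simp: PiE_def)
  show "x_shift_entry g g' = 0"
    unfolding gg tensor_entry_def prod.case tensor_based_split x_shift_coeff_eq l by simp
  show "x_entry g g' = (if g' = g then H_var else 0)"
  proof (cases "\<alpha> = \<beta>")
    case True
    have "l' = l \<longleftrightarrow> l' ?c = LX \<and> (\<forall>c'\<in>circles D \<alpha> - {?c}. l c' = l' c')"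
    proof
      assume *: "l' ?c = LX \<and> (\<forall>c'\<in>circles D \<alpha> - {?c}. l c' = l' c')"
      show "l' = l"
      proof (rule extensionalityI)
        fix c assume "c \<in> circles D \<alpha>"
        thus "l' c = l c" using * l by (cases "c = ?c") auto
      qed (use ext True in simp_all)
    qed (use l in simp)
    moreover have "x_entry g g' = x_coeff LX (l' ?c) *
        (if \<forall>c'\<in>circles D \<alpha> - {?c}. l c' = l' c' then 1 else 0)"
      using True finite_circles
      unfolding gg tensor_entry_def prod.case tensor_based_split l by (simp add: tensor_id)
    ultimately show ?thesis
      using True unfolding gg x_coeff_def by auto
  qed (simp add: gg tensor_entry_def)
qed

lemma retraction_entry_not_x:
  assumes "g' \<in> gens D i" "g' \<notin> based_gens LX D p i"
  shows "retraction_entry g g' = 0"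
  using entries_not_x[OF assms] by (simp add: retraction_entry_def)

text \<open>Hence \<open>(X \<sigma> - X) / H\<close> is \<open>-H / H = 1\<close> on the reduced subcomplex.\<close>

lemma retraction_entry_from_x:
  assumes "g \<in> based_gens LX D p i" "g' \<in> gens D i"
  shows "retraction_entry g g' = (if g' = g then 1 else 0)"
proof -
  have "- H_var = H_var" using bit_poly_add_self[of H_var] by (simp add: minus_unique)
  thus ?thesis
    using entries_from_x[OF assms] H_var_nonzero by (simp add: retraction_entry_def)
qed

lemma retraction_entry_commutes:
  assumes "g \<in> gens D i" "g' \<in> gens D (i + 1)"
  shows "(\<Sum>h\<in>gens D i. retraction_entry g h * BN_coeff D h g') =
         (\<Sum>h\<in>gens D (i + 1). BN_coeff D g h * retraction_entry h g')"
proof -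
  \<comment> \<open>The identity is checked after multiplication by \<open>H\<close>, where both sides are differences of
    tensor operators.\<close>
  have "H_var * (\<Sum>h\<in>gens D i. retraction_entry g h * BN_coeff D h g') =
      (\<Sum>h\<in>gens D i. (H_var * retraction_entry g h) * BN_coeff D h g')"
    by (simp add: sum_distrib_left mult_ac)
  also have "\<dots> = (\<Sum>h\<in>gens D (i + 1). BN_coeff D g h * (H_var * retraction_entry h g'))"
    unfolding H_retraction_entry left_diff_distrib right_diff_distrib sum_subtractf
      tensor_entry_commutes[OF linear_pair_x assms] tensor_entry_commutes[OF linear_pair_x_shift assms] ..
  also have "\<dots> = H_var * (\<Sum>h\<in>gens D (i + 1). BN_coeff D g h * retraction_entry h g')"
    by (simp add: sum_distrib_left mult_ac)
  finally show ?thesis using H_var_nonzero by simp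
qed

text \<open>If \<open>f\<close> lies in the span of the labellings with \<open>x\<close> at the basepoint, then \<open>H d f = d X f = X d f\<close> lies
there, and \<open>H\<close> can be cancelled.\<close>

lemma BN_coeff_x_subcomplex:
  assumes g: "g \<in> based_gens LX D p i"
    and g': "g' \<in> gens D (i + 1)" "g' \<notin> based_gens LX D p (i + 1)"
  shows "BN_coeff D g g' = 0"
proof -
  have gi: "g \<in> gens D i" using g by (auto simp: based_gens_def)
  \<comment> \<open>The sum has the single nonzero term \<open>h = g\<close>.\<close>
  have "H_var * BN_coeff D g g' = (\<Sum>h\<in>gens D i. x_entry g h * BN_coeff D h g')"
    using gi finite_gens entries_from_x(1)[OF g]
    by (simp add: if_distrib[of "\<lambda>a. a * _"] sum.delta' cong: sum.cong if_cong)
  also have "\<dots> = (\<Sum>h\<in>gens D (i + 1). BN_coeff D g h * x_entry h g')"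
    by (rule tensor_entry_commutes[OF linear_pair_x gi g'(1)])
  also have "\<dots> = 0"
    using entries_not_x(1)[OF g'] by simp
  finally show ?thesis using H_var_nonzero by simp
qed

abbreviation retraction :: "int \<Rightarrow> ('a gen \<Rightarrow> bit poly) \<Rightarrow> 'a gen \<Rightarrow> bit poly" where
  "retraction i \<equiv> matrix_map (gens D i) (based_gens LX D p i) retraction_entry"

lemma based_gens_subset: "based_gens v D p i \<subseteq> gens D i"
  by (auto simp: based_gens_def)

lemma gens_cases: "gens D i - based_gens LX D p i = based_gens L1 D p i"
  unfolding based_gens_def by auto (metis label.exhaust)+

lemma retraction_alt: "retraction i = matrix_map (gens D i) (gens D i) retraction_entry"
  using based_gens_subset retraction_entry_not_x
  by (auto simp: matrix_map_def fun_eq_iff)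

lemma retraction_id:
  assumes "f \<in> carrier (free_module (based_gens LX D p i))"
  shows "retraction i f = f"
proof
  fix h
  have f0: "f g = 0" if "g \<notin> based_gens LX D p i" for g
    using free_module_outside[OF assms that] .
  show "retraction i f h = f h"
  proof (cases "h \<in> based_gens LX D p i")
    case True
    hence h: "h \<in> gens D i" using based_gens_subset by auto
    have "retraction_entry g h * f g = (if g = h then f g else 0)" for g
      using retraction_entry_from_x[OF _ h, of g] f0[of g]
      by (cases "g \<in> based_gens LX D p i") auto
    thus ?thesis using True h finite_gens by (simp add: matrix_map_def)
  qed (simp add: matrix_map_def f0)
qed

lemma retraction_BN_diff:
  "retraction (i + 1) (BN_diff D i f) = BN_diff D i (retraction i f)"
  unfolding retraction_alt BN_diff_eq_matrix_map matrix_map_comp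
  by (rule matrix_map_cong) (simp add: retraction_entry_commutes)

lemma proj_C1_linear:
  "linear_map ring_of_type_algebra (free_module S) (free_module (based_gens L1 D p i)) (proj_C1 D p i)"
  by (auto simp: linear_map_def free_module_def proj_C1_def fun_eq_iff)

lemma proj_C1_BN_diff:
  "proj_C1 D p (i + 1) (BN_diff D i f) = proj_C1 D p (i + 1) (BN_diff D i (proj_C1 D p i f))"
proof
  fix h
  show "proj_C1 D p (i + 1) (BN_diff D i f) h =
      proj_C1 D p (i + 1) (BN_diff D i (proj_C1 D p i f)) h"
  proof (cases "h \<in> based_gens L1 D p (i + 1)")
    case True
    hence h: "h \<in> gens D (i + 1)" "h \<notin> based_gens LX D p (i + 1)"
      by (auto simp: based_gens_def)
    have "(\<Sum>g\<in>gens D i. BN_coeff D g h * f g) =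
        (\<Sum>g\<in>gens D i. BN_coeff D g h * proj_C1 D p i f g)"
      using BN_coeff_x_subcomplex[OF _ h] gens_cases[of i]
      by (intro sum.cong refl) (auto simp: proj_C1_def)
    thus ?thesis using True h by (simp add: proj_C1_def BN_diff_eq_matrix_map matrix_map_def)
  qed (simp add: proj_C1_def)
qed

text \<open>A retraction onto a submodule splits the module into the submodule and the quotient: the inverse sends
\<open>(a, b)\<close> to \<open>a + b - r b\<close>, and the sign disappears in characteristic \<open>2\<close>.\<close>

lemma retraction_proj_bij:
  "bij_betw (\<lambda>f. (retraction i f, proj_C1 D p i f)) (carrier (free_module (gens D i)))
     (carrier (free_module (based_gens LX D p i)) \<times> carrier (free_module (based_gens L1 D p i)))"
proof -
  let ?r = "retraction i" and ?q = "proj_C1 D p i"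
  let ?C = "carrier (free_module (gens D i)) :: ('a gen \<Rightarrow> bit poly) set"
  let ?X = "carrier (free_module (based_gens LX D p i)) :: ('a gen \<Rightarrow> bit poly) set"
  let ?O = "carrier (free_module (based_gens L1 D p i)) :: ('a gen \<Rightarrow> bit poly) set"
  have r_add: "?r (\<lambda>g. f g + f' g) = (\<lambda>g. ?r f g + ?r f' g)" for f f'
    by (auto simp: matrix_map_def fun_eq_iff algebra_simps sum.distrib)
  have r_mem: "?r f \<in> ?X" for f
    by (auto simp: matrix_map_def free_module_def)
  have qX: "?q f = (\<lambda>g. 0)" if "f \<in> ?X" for f
    using that by (auto simp: proj_C1_def free_module_def fun_eq_iff based_gens_def)
  have qO: "?q f = f" if "f \<in> ?O" for f
    using that by (auto simp: proj_C1_def free_module_def fun_eq_iff)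
  have kerq: "(\<lambda>g. f g + ?q f g) \<in> ?X" if "f \<in> ?C" for f
  proof -
    have "f g + ?q f g = 0" if "g \<notin> based_gens LX D p i" for g
      using that gens_cases[of i] bit_poly_add_self[of "f g"] free_module_outside[OF \<open>f \<in> ?C\<close>, of g]
      by (cases "g \<in> gens D i") (auto simp: proj_C1_def)
    thus ?thesis by (simp add: free_module_def)
  qed
  have eq: "f = (\<lambda>g. ?r f g + (?q f g + ?r (?q f) g))" if "f \<in> ?C" for f
  proof
    fix g
    have "f g + ?q f g = ?r f g + ?r (?q f) g"
      using fun_cong[OF retraction_id[OF kerq[OF that]], of g] r_add[of f "?q f"] by simp
    hence "f g + ?q f g + ?q f g = ?r f g + (?q f g + ?r (?q f) g)"
      by (simp only: add_ac)
    thus "f g = ?r f g + (?q f g + ?r (?q f) g)"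
      by (simp only: add.assoc bit_poly_add_self add_0_right)
  qed
  have "inj_on (\<lambda>f. (?r f, ?q f)) ?C"
  proof (rule inj_onI)
    fix f f' assume f: "f \<in> ?C" "f' \<in> ?C" "(?r f, ?q f) = (?r f', ?q f')"
    hence "?r f = ?r f'" "?q f = ?q f'" by simp_all
    thus "f = f'" using eq[OF f(1)] eq[OF f(2)] by simp
  qed
  moreover have "(\<lambda>f. (?r f, ?q f)) ` ?C = ?X \<times> ?O"
  proof (intro equalityI subsetI)
    fix y assume "y \<in> (\<lambda>f. (?r f, ?q f)) ` ?C"
    thus "y \<in> ?X \<times> ?O"
      using r_mem by (auto simp: proj_C1_def free_module_def)
  next
    fix y assume "y \<in> ?X \<times> ?O"
    then obtain a b where y: "y = (a, b)" and ab: "a \<in> ?X" "b \<in> ?O" by auto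
    define f where "f = (\<lambda>g. a g + (b g + ?r b g))"
    have "?r f = (\<lambda>g. ?r a g + (?r b g + ?r (?r b) g))"
      unfolding f_def by (simp add: r_add)
    hence rf: "?r f = a"
      by (simp only: retraction_id[OF ab(1)] retraction_id[OF r_mem] bit_poly_add_self add_0_right)
    have "?q f = (\<lambda>g. ?q a g + (?q b g + ?q (?r b) g))"
      by (simp add: f_def proj_C1_def fun_eq_iff)
    hence qf: "?q f = b"
      by (simp only: qX[OF ab(1)] qX[OF r_mem] qO[OF ab(2)] add_0_left add_0_right)
    have "f g = 0" if "g \<notin> gens D i" for g
    proof -
      have "g \<notin> based_gens LX D p i" "g \<notin> based_gens L1 D p i"
        using that based_gens_subset by auto
      thus ?thesis
        using free_module_outside[OF ab(1), of g] free_module_outside[OF ab(2), of g]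
          free_module_outside[OF r_mem, of g b] unfolding f_def by simp
    qed
    hence "f \<in> ?C" by (simp add: free_module_def)
    thus "y \<in> (\<lambda>f. (?r f, ?q f)) ` ?C" using rf qf y by (auto intro!: image_eqI[of _ _ f])
  qed
  ultimately show ?thesis unfolding bij_betw_def by blast
qed

lemma BN_homology_splits:
  "module_isomorphic ring_of_type_algebra (homology (BN_complex D) i)
     (direct_sum_module (homology (Cx_complex D p) i) (homology (C1_complex D p) i))"
proof (rule homology_of_direct_sum[where f = retraction and g = "proj_C1 D p"])
  fix i
  show "linear_map ring_of_type_algebra (chain_module (BN_complex D) i)
      (chain_module (Cx_complex D p) i) (retraction i)"
    by (simp add: BN_complex_def Cx_complex_def matrix_map_linear)
  show "linear_map ring_of_type_algebra (chain_module (BN_complex D) i)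
      (chain_module (C1_complex D p) i) (proj_C1 D p i)"
    by (simp add: BN_complex_def C1_complex_def proj_C1_linear)
  show "bij_betw (\<lambda>f. (retraction i f, proj_C1 D p i f)) (carrier (chain_module (BN_complex D) i))
      (carrier (chain_module (Cx_complex D p) i) \<times> carrier (chain_module (C1_complex D p) i))"
    using retraction_proj_bij by (simp add: BN_complex_def Cx_complex_def C1_complex_def)
  fix f
  show "differential (BN_complex D) i f \<in> carrier (chain_module (BN_complex D) (i + 1))"
    by (simp add: BN_complex_def free_module_def BN_diff_def)
  show "retraction (i + 1) (differential (BN_complex D) i f) =
      differential (Cx_complex D p) i (retraction i f)"
    by (simp add: BN_complex_def Cx_complex_def retraction_BN_diff)
  show "proj_C1 D p (i + 1) (differential (BN_complex D) i f) =
      differential (C1_complex D p) i (proj_C1 D p i f)"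
    unfolding BN_complex_def C1_complex_def by (simp add: proj_C1_BN_diff[of i f])
qed (simp_all add: BN_complex_def Cx_complex_def C1_complex_def module_free_module)

end

theorem theorem3:
  fixes D :: "'a diagram" and p :: 'a
  assumes "oriented_link_diagram D" and "p \<in> arcs D"
  shows "\<forall>i::int. module_isomorphic (ring_of_type_algebra :: bit poly ring)
           (homology (BN_complex D) i)
           (direct_sum_module (homology (Cx_complex D p) i) (homology (C1_complex D p) i))"
proof -
  interpret based_diagram D p
    using assms by unfold_locales (auto simp: oriented_link_diagram_def)
  show ?thesis using BN_homology_splits by blast
qed

end
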